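(* For $|z|$ sufficiently large, \begin{align*} g_1\!\left(3(z+z^{-1})\right)&=\frac1{20}f_4\!\left(\frac{9(3+z^2)^4}{z^6}\right)+\frac3{20}f_4\!\left(\frac{9(3+z^{-2})^4}{z^{-6}}\right),\\ g_2(z)&=-\frac1{15}f_3\!\left(\frac{(16-z)^3}{z^2}\right)+\frac8{15}f_3\!\left(-\frac{(4-z)^3}{z}\right). \end{align*}
   Context: Mahler measure of a Laurent polynomial: $\mathrm{m}(P)=\int_{[0,1]^n}\log|P(e^{2\pi i\theta_1},\dots,e^{2\pi i\theta_n})|\,d\theta$. Define $g_1(u)=\mathrm{m}(u+x+x^{-1}+y+y^{-1}+z+z^{-1})$, $g_2(u)=\mathrm{m}(-u+4+(x+x^{-1})(y+y^{-1})+(x+x^{-1})(z+z^{-1})+(y+y^{-1})(z+z^{-1}))$, $f_3(u)=\mathrm{m}(u-(x+x^{-1})^2(y+y^{-1})^2(1+z)^3z^{-2})$, and $f_4(u)=4\,\mathrm{m}(x^4+y^4+z^4+1+u^{1/4}xyz)$ (any choice of fourth root). *)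

theory Defs
  imports "HOL-Analysis.Analysis"
begin

definition torus_point :: "real^'n \<Rightarrow> complex^'n" where
  "torus_point \<theta> = (\<chi> i. exp (2 * of_real pi * \<i> * of_real (\<theta> $ i)))"

text \<open>
  A Laurent polynomial in variables indexed by \<open>'n\<close> is represented by the function it induces on
  \<open>complex^'n\<close>.  The value \<open>ln 0 = 0\<close> is immaterial, since the zeros of a nonzero Laurent
  polynomial on the torus form a null set.
\<close>

definition mahler_measure :: "(complex^'n \<Rightarrow> complex) \<Rightarrow> real" where
  "mahler_measure P = (LINT \<theta>:cbox 0 1|lborel. ln (cmod (P (torus_point \<theta>))))"

definition g1 :: "complex \<Rightarrow> real" where
  "g1 u = mahler_measure (\<lambda>v :: complex^3. let x = v $ 1; y = v $ 2; z = v $ 3 in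
     u + x + inverse x + y + inverse y + z + inverse z)"

definition g2 :: "complex \<Rightarrow> real" where
  "g2 u = mahler_measure (\<lambda>v :: complex^3. let x = v $ 1; y = v $ 2; z = v $ 3 in
     - u + 4 + (x + inverse x) * (y + inverse y) + (x + inverse x) * (z + inverse z)
       + (y + inverse y) * (z + inverse z))"

definition f3 :: "complex \<Rightarrow> real" where
  "f3 u = mahler_measure (\<lambda>v :: complex^3. let x = v $ 1; y = v $ 2; z = v $ 3 in
     u - (x + inverse x)^2 * (y + inverse y)^2 * (1 + z)^3 * z powi (-2))"

text \<open>
  The principal fourth root is used here; the lemma \<open>f4_any_root\<close> below shows that every other
  fourth root gives the same value.
\<close>

definition f4 :: "complex \<Rightarrow> real" where
  "f4 u = 4 * mahler_measure (\<lambda>v :: complex^3. let x = v $ 1; y = v $ 2; z = v $ 3 in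
     x^4 + y^4 + z^4 + 1 + (u powr (1/4)) * x * y * z)"

lemma nn_integral_translate:
  fixes g :: "real^'n \<Rightarrow> ennreal"
  assumes [measurable]: "g \<in> borel_measurable borel"
  shows "(\<integral>\<^sup>+ x. g (x + a) \<partial>lborel) = (\<integral>\<^sup>+ x. g x \<partial>lborel)"
proof -
  have "(\<integral>\<^sup>+ x. g x \<partial>lborel) = (\<integral>\<^sup>+ x. g x \<partial>distr lborel borel ((+) a))"
    by (simp add: lborel_distr_plus)
  also have "\<dots> = (\<integral>\<^sup>+ x. g (a + x) \<partial>lborel)"
    by (subst nn_integral_distr) auto
  finally show ?thesis by (simp add: add.commute)
qed

lemma nn_integral_cube_periodic_shift:
  fixes g :: "real^'n \<Rightarrow> ennreal"
  assumes g [measurable]: "g \<in> borel_measurable borel"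
    and per: "\<And>\<theta>. g (\<theta> + axis k 1) = g \<theta>"
    and c: "0 \<le> c" "c \<le> 1"
  shows "(\<integral>\<^sup>+ \<theta>. g (\<theta> + axis k c) * indicator (cbox 0 1) \<theta> \<partial>lborel)
       = (\<integral>\<^sup>+ \<theta>. g \<theta> * indicator (cbox 0 1) \<theta> \<partial>lborel)"
proof -
  define S where "S a b = {\<theta> :: real^'n. (\<forall>i. i \<noteq> k \<longrightarrow> 0 \<le> \<theta> $ i \<and> \<theta> $ i \<le> 1) \<and> a \<le> \<theta> $ k \<and> \<theta> $ k < b}"
    for a b
  have [measurable]: "S a b \<in> sets borel" for a b
    unfolding S_def by measurable
  have null: "AE \<theta> in lborel. \<theta> $ k \<noteq> (1 :: real)"
  proof -
    have "{\<theta> :: real^'n. \<theta> $ k = 1} \<in> null_sets lebesgue"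
      using negligible_standard_hyperplane[of "axis k 1 :: real^'n" 1]
      by (simp add: negligible_iff_null_sets cart_eq_inner_axis)
    then have "{\<theta> :: real^'n. \<theta> $ k = 1} \<in> null_sets lborel"
      by (simp add: null_sets_completion_iff)
    from AE_not_in[OF this] show ?thesis by simp
  qed
  have cube: "(\<integral>\<^sup>+ \<theta>. h \<theta> * indicator (cbox 0 1) \<theta> \<partial>lborel) = (\<integral>\<^sup>+ \<theta>. h \<theta> * indicator (S 0 1) \<theta> \<partial>lborel)"
    for h :: "real^'n \<Rightarrow> ennreal"
  proof (rule nn_integral_cong_AE, use null in eventually_elim)
    fix \<theta> :: "real^'n" assume *: "\<theta> $ k \<noteq> 1"
    have "\<theta> \<in> cbox 0 1 \<longleftrightarrow> (\<forall>i. 0 \<le> \<theta> $ i \<and> \<theta> $ i \<le> 1)"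
      by (simp add: mem_box_cart)
    also have "\<dots> \<longleftrightarrow> \<theta> \<in> S 0 1"
      using * unfolding S_def mem_Collect_eq by (metis order_less_le)
    finally show "h \<theta> * indicator (cbox 0 1) \<theta> = h \<theta> * indicator (S 0 1) \<theta>"
      by (simp add: indicator_def)
  qed
  have split: "(\<integral>\<^sup>+ \<theta>. g \<theta> * indicator (S a d) \<theta> \<partial>lborel)
     = (\<integral>\<^sup>+ \<theta>. g \<theta> * indicator (S a b) \<theta> \<partial>lborel) + (\<integral>\<^sup>+ \<theta>. g \<theta> * indicator (S b d) \<theta> \<partial>lborel)"
    if "a \<le> b" "b \<le> d" for a b d
    using that by (subst nn_integral_add[symmetric])
       (auto intro!: nn_integral_cong simp: indicator_def S_def)
  have shift: "indicator (S (a + t) (b + t)) (\<theta> + axis k t) = (indicator (S a b) \<theta> :: ennreal)"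
    for a b t \<theta>
    by (auto simp: indicator_def S_def axis_def)
  have "(\<integral>\<^sup>+ \<theta>. g (\<theta> + axis k c) * indicator (S 0 1) \<theta> \<partial>lborel)
      = (\<integral>\<^sup>+ \<theta>. g (\<theta> + axis k c) * indicator (S (0 + c) (1 + c)) (\<theta> + axis k c) \<partial>lborel)"
    by (simp only: shift)
  also have "\<dots> = (\<integral>\<^sup>+ \<theta>. g \<theta> * indicator (S (0 + c) (1 + c)) \<theta> \<partial>lborel)"
    by (rule nn_integral_translate[of "\<lambda>\<theta>. g \<theta> * indicator (S (0 + c) (1 + c)) \<theta>"]) measurable
  also have "\<dots> = (\<integral>\<^sup>+ \<theta>. g \<theta> * indicator (S c 1) \<theta> \<partial>lborel)
      + (\<integral>\<^sup>+ \<theta>. g \<theta> * indicator (S (0 + 1) (c + 1)) \<theta> \<partial>lborel)"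
    using split[of c 1 "1 + c"] c by (simp add: add.commute)
  also have "(\<integral>\<^sup>+ \<theta>. g \<theta> * indicator (S (0 + 1) (c + 1)) \<theta> \<partial>lborel)
      = (\<integral>\<^sup>+ \<theta>. g (\<theta> + axis k 1) * indicator (S (0 + 1) (c + 1)) (\<theta> + axis k 1) \<partial>lborel)"
    by (rule nn_integral_translate[symmetric, of "\<lambda>\<theta>. g \<theta> * indicator (S (0 + 1) (c + 1)) \<theta>"]) measurable
  also have "\<dots> = (\<integral>\<^sup>+ \<theta>. g \<theta> * indicator (S 0 c) \<theta> \<partial>lborel)"
    by (simp only: shift per)
  also have "(\<integral>\<^sup>+ \<theta>. g \<theta> * indicator (S c 1) \<theta> \<partial>lborel) + (\<integral>\<^sup>+ \<theta>. g \<theta> * indicator (S 0 c) \<theta> \<partial>lborel)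
      = (\<integral>\<^sup>+ \<theta>. g \<theta> * indicator (S 0 1) \<theta> \<partial>lborel)"
    using split[of 0 c 1] c by (simp add: add.commute)
  finally show ?thesis by (simp only: cube)
qed

lemma set_integral_cube_periodic_shift:
  fixes G :: "real^'n \<Rightarrow> real"
  assumes G [measurable]: "G \<in> borel_measurable borel"
    and per: "\<And>\<theta>. G (\<theta> + axis k 1) = G \<theta>"
    and c: "0 \<le> c" "c \<le> 1"
  shows "(LINT \<theta>:cbox 0 1|lborel. G (\<theta> + axis k c)) = (LINT \<theta>:cbox 0 1|lborel. G \<theta>)"
proof -
  have pos: "ennreal (indicator A \<theta> *\<^sub>R r) = ennreal r * indicator A \<theta>"
    and neg: "ennreal (- (indicator A \<theta> *\<^sub>R r)) = ennreal (- r) * indicator A \<theta>"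
    for A and \<theta> :: "real^'n" and r :: real
    by (auto simp: indicator_def)
  have eq_pos: "(\<integral>\<^sup>+ \<theta>. ennreal (G (\<theta> + axis k c)) * indicator (cbox 0 1) \<theta> \<partial>lborel)
       = (\<integral>\<^sup>+ \<theta>. ennreal (G \<theta>) * indicator (cbox 0 1) \<theta> \<partial>lborel)"
    by (rule nn_integral_cube_periodic_shift) (use c in \<open>simp_all add: per\<close>)
  have eq_neg: "(\<integral>\<^sup>+ \<theta>. ennreal (- G (\<theta> + axis k c)) * indicator (cbox 0 1) \<theta> \<partial>lborel)
       = (\<integral>\<^sup>+ \<theta>. ennreal (- G \<theta>) * indicator (cbox 0 1) \<theta> \<partial>lborel)"
    by (rule nn_integral_cube_periodic_shift[of "\<lambda>\<theta>. ennreal (- G \<theta>)"]) (use c in \<open>simp_all add: per\<close>)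
  let ?F = "\<lambda>\<theta>. indicator (cbox 0 1) \<theta> *\<^sub>R G (\<theta> + axis k c)"
  let ?H = "\<lambda>\<theta>. indicator (cbox 0 1) \<theta> *\<^sub>R G \<theta>"
  have [measurable]: "?F \<in> borel_measurable lborel" "?H \<in> borel_measurable lborel"
    by measurable
  have iff: "integrable lborel ?F \<longleftrightarrow> integrable lborel ?H"
    unfolding real_integrable_def pos neg eq_pos eq_neg by simp
  show ?thesis
  proof (cases "integrable lborel ?H")
    case True
    with iff have "integrable lborel ?F" by simp
    with True show ?thesis
      unfolding set_lebesgue_integral_def
      by (simp only: real_lebesgue_integral_def pos neg eq_pos eq_neg)
  next
    case False
    with iff show ?thesis
      unfolding set_lebesgue_integral_def by (simp add: not_integrable_integral_eq)
  qed
qed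

lemma mahler_measure_rotate:
  fixes P :: "complex^'n \<Rightarrow> complex"
  assumes [measurable]: "(\<lambda>\<theta>. P (torus_point \<theta>)) \<in> borel_measurable borel"
    and r: "cmod r = 1"
  shows "mahler_measure (\<lambda>v. P (\<chi> i. if i = k then r * v $ i else v $ i)) = mahler_measure P"
proof -
  define c where "c = Arg2pi r / (2 * pi)"
  have c: "0 \<le> c" "c \<le> 1"
    using Arg2pi_ge_0[of r] Arg2pi_lt_2pi[of r] by (auto simp: c_def)
  have r_eq: "r = exp (2 * of_real pi * \<i> * of_real c)"
    using Arg2pi_eq[of r] r by (simp add: c_def mult_ac)
  have rot: "torus_point (\<theta> + axis k c) = (\<chi> i. if i = k then r * torus_point \<theta> $ i else torus_point \<theta> $ i)"
    for \<theta> :: "real^'n"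
    by (auto simp: vec_eq_iff torus_point_def axis_def r_eq exp_add[symmetric] algebra_simps)
  have per: "torus_point (\<theta> + axis k 1) = torus_point \<theta>" for \<theta> :: "real^'n"
    by (auto simp: vec_eq_iff torus_point_def axis_def exp_add algebra_simps)
  show ?thesis
    unfolding mahler_measure_def rot[symmetric]
    by (rule set_integral_cube_periodic_shift) (use c in \<open>simp_all add: per\<close>)
qed

lemma f4_any_root:
  assumes w: "w ^ 4 = u"
  shows "f4 u = 4 * mahler_measure (\<lambda>v :: complex^3. let x = v $ 1; y = v $ 2; z = v $ 3 in
     x^4 + y^4 + z^4 + 1 + w * x * y * z)"
proof -
  define Q where "Q = (\<lambda>w (v :: complex^3). (v $ 1)^4 + (v $ 2)^4 + (v $ 3)^4 + 1 + w * v $ 1 * v $ 2 * v $ 3)"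
  define s where "s = u powr (1/4)"
  have s: "s ^ 4 = u"
  proof (cases "u = 0")
    case False
    then show ?thesis
      by (simp add: s_def powr_def exp_of_nat_mult[symmetric])
  qed (simp add: s_def)
  have "mahler_measure (Q s) = mahler_measure (Q w)"
  proof (cases "u = 0")
    case True
    with s w show ?thesis by simp
  next
    case False
    define r where "r = s / w"
    have w0: "w \<noteq> 0" using False w by auto
    have r4: "r ^ 4 = 1" using s w False by (simp add: r_def power_divide)
    then have "cmod r ^ 4 = 1" by (metis norm_one norm_power)
    then have r1: "cmod r = 1"
      using power_eq_iff_eq_base[of 4 "cmod r" 1] by simp
    have Qs: "Q s v = Q w (\<chi> i. if i = 1 then r * v $ i else v $ i)" for v
      using w0 r4 by (simp add: Q_def power_mult_distrib) (simp add: r_def)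
    have "(\<lambda>\<theta>. Q w (torus_point \<theta>)) \<in> borel_measurable borel"
      unfolding Q_def torus_point_def by (intro borel_measurable_continuous_onI) (auto intro!: continuous_intros)
    from mahler_measure_rotate[OF this r1, of 1] show ?thesis
      unfolding Qs[symmetric] .
  qed
  then show ?thesis
    by (simp add: f4_def Let_def Q_def s_def)
qed

end

theory Submission
  imports Defs "HOL-Complex_Analysis.Complex_Analysis"
begin

text \<open>
  For large parameters a Mahler measure \<open>m(u - Q)\<close> equals
  \<open>ln |u| - Re (\<Sum>n\<ge>1. c(n) / (n u^n))\<close>, where \<open>c(n)\<close> is the constant term of \<open>Q^n\<close>.  With
  \<open>t = 1 / (9z\<^sup>2)\<close> the three arguments \<open>X\<close> in the first identity satisfy \<open>1/X = t^p / (1 - ct)^q\<close> for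
  \<open>(p, q, c) = (1, 2, -9), (1, 4, -27), (3, 4, -3)\<close> (where \<open>X\<close> is the square of the argument of \<open>g\<^sub>1\<close>),
  and \<open>t = 1/z\<close> does the same for the second identity.  If \<open>H\<close> is the generating function of the
  constant terms, then \<open>a(t) = H(1/X) / (1 - ct)\<close> is in all three cases the generating function of the
  Almkvist--Zudilin numbers, and of the Domb numbers for the second identity: the coefficients satisfy
  a common recurrence of order two, proved by creative telescoping.  Consequently
  \<open>U(t) = q ln (1 - ct) - \<Sum>n\<ge>1. c(n) / (n X^n)\<close> satisfies
  \<open>t U'(t) = p - a(t) (p + (q - p) c t)\<close>, and each identity reduces to a linear relation between
  these right-hand sides.
\<close>

text \<open>The formula for \<open>t U'(t)\<close> is linear in the data, so an identity with
  weights \<open>w\<close> holds as soon as two sums over its terms balance: that of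
  \<open>w p\<close> and that of \<open>w (q - p) c\<close>. The rational weights in the theorem
  satisfy exactly these conditions. The first one also cancels the multiples of
  \<open>ln |t|\<close> that separate the Mahler measures from \<open>Re U\<close>, and
  \<open>U(0) = 0\<close> fixes the constant of integration. The \<open>g1\<close> term has weight
  1/2, because its argument is only a square root of \<open>X\<close>. The second identity uses
  \<open>(p, q, c) = (1, 1, 0), (1, 3, 16), (2, 3, 4)\<close>; for the middle triple
  \<open>X\<close> is minus the argument of \<open>f3\<close>, so the constant terms enter with
  alternating signs. An obstacle is that the coefficient sequences are sums over different ranges:
  the binomial \<open>(n + (q - p) k choose q k)\<close> vanishes for \<open>p k > n\<close>.
  Writing reciprocals of factorials as values of \<open>rGamma\<close> extends every summand to all
  \<open>k\<close> and reduces the recurrences to polynomial identities.\<close>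

no_notation fps_nth (infixl \<open>$\<close> 75)

section \<open>Creative telescoping\<close>

lemma rGamma_of_nat_diff:
  assumes "n < k"
  shows "rGamma (of_nat n - of_nat k + 1 :: complex) = 0"
proof -
  from assms obtain j where "k = Suc (n + j)"
    using less_imp_Suc_add by auto
  then have "(of_nat n - of_nat k + 1 :: complex) = - of_nat j"
    by simp
  then show ?thesis by (simp only: rGamma_eq_zero_iff) simp
qed

text \<open>Unlike the quotient of factorials, this form is valid for \<open>k > n\<close> as well,
  where \<open>rGamma\<close> has a zero; shifts of \<open>n\<close> and \<open>k\<close> then only
  produce polynomial factors, with no case split.\<close>

lemma binomial_rGamma:
  "of_nat (n choose k) = fact n / fact k * rGamma (of_nat n - of_nat k + 1 :: complex)"
proof (cases "k \<le> n")
  case True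
  then have "rGamma (of_nat n - of_nat k + 1 :: complex) = inverse (fact (n - k))"
    using Gamma_fact[of "n - k", where 'a = complex]
    by (simp add: rGamma_inverse_Gamma of_nat_diff add.commute)
  with True show ?thesis
    by (simp add: binomial_fact field_simps)
next
  case False
  then show ?thesis by (simp add: rGamma_of_nat_diff)
qed

text \<open>Everything is expressed through the largest argument: going down multiplies by linear
  factors, so nothing is divided at the zeros of \<open>rGamma\<close>.\<close>

lemma rGamma_down:
  fixes z :: complex
  shows "rGamma (z + 2) = (z + 2) * rGamma (z + 3)"
    and "rGamma (z + 1) = (z + 1) * ((z + 2) * rGamma (z + 3))"
    and "rGamma z = z * ((z + 1) * ((z + 2) * rGamma (z + 3)))"
  using rGamma_plus1[of z] rGamma_plus1[of "z + 1"] rGamma_plus1[of "z + 2"]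
  by (simp_all add: add.assoc)

lemma recurrence_unique:
  fixes A B C S T :: "nat \<Rightarrow> complex"
  assumes "\<And>n. A n * S (n + 2) + B n * S (n + 1) + C n * S n = 0"
    and "\<And>n. A n * T (n + 2) + B n * T (n + 1) + C n * T n = 0"
    and "\<And>n. A n \<noteq> 0" and "S 0 = T 0" "S 1 = T 1"
  shows "S n = T n"
proof (induction n rule: less_induct)
  case (less n)
  consider "n = 0" | "n = 1" | m where "n = m + 2"
    by (metis One_nat_def add.commute less_2_cases le_add_diff_inverse not_less)
  then show ?case
  proof cases
    case (3 m)
    then have "S (m + 1) = T (m + 1)" "S m = T m"
      using less by auto
    with assms(1,2)[of m] have "A m * S (m + 2) = A m * T (m + 2)"
      by (metis add_right_cancel)
    with assms(3) 3 show ?thesis by simp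
  qed (use assms in auto)
qed

text \<open>The terms beyond the natural ranges vanish, so all three sums can run over
  \<open>k < n + 3\<close>; there the right-hand side telescopes between two zeros of
  \<open>G\<close>.\<close>

lemma zeilberger_recurrence:
  fixes F G :: "nat \<Rightarrow> nat \<Rightarrow> complex"
  assumes cert: "\<And>n k. A n * F (n + 2) k + B n * F (n + 1) k + C n * F n k = G n (Suc k) - G n k"
    and "\<And>n. G n 0 = 0" and "\<And>n. G n (n + 3) = 0"
    and F0: "\<And>n k. n < k \<Longrightarrow> F n k = 0"
  shows "A n * (\<Sum>k\<le>n+2. F (n + 2) k) + B n * (\<Sum>k\<le>n+1. F (n + 1) k) + C n * (\<Sum>k\<le>n. F n k) = 0"
proof -
  have ext: "(\<Sum>k\<le>m. F m k) = (\<Sum>k<n+3. F m k)" if "m \<le> n + 2" for m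
    by (rule sum.mono_neutral_left) (use that F0 in auto)
  have "A n * (\<Sum>k\<le>n+2. F (n + 2) k) + B n * (\<Sum>k\<le>n+1. F (n + 1) k) + C n * (\<Sum>k\<le>n. F n k)
      = (\<Sum>k<n+3. A n * F (n + 2) k + B n * F (n + 1) k + C n * F n k)"
    using ext[of "n + 2"] ext[of "n + 1"] ext[of n] by (simp add: sum.distrib sum_distrib_left del: sum.atMost_Suc sum.lessThan_Suc add_2_eq_Suc' One_nat_def add_Suc_right)
  also have "\<dots> = G n (n + 3) - G n 0"
    by (simp only: cert sum_lessThan_telescope)
  finally show ?thesis using assms by simp
qed

text \<open>The coefficients of \<open>B (X^p / (1 - c X)^q) / (1 - c X)\<close>, where \<open>B\<close> is the generating function of
  \<open>b\<close>.  The binomial coefficient vanishes whenever the truncated subtraction in the exponent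
  differs from the true one.\<close>

definition comp_coeff :: "nat \<Rightarrow> nat \<Rightarrow> complex \<Rightarrow> (nat \<Rightarrow> complex) \<Rightarrow> nat \<Rightarrow> complex" where
  "comp_coeff p q c b n = (\<Sum>k\<le>n. b k * of_nat ((n + (q - p) * k) choose (q * k)) * c ^ (n - p * k))"

text \<open>Rests on \<open>(n + (q - p) k) - q k = n - p k\<close>; for \<open>p k > n\<close> the
  binomial and \<open>rGamma\<close> vanish together. The last factor depends on \<open>k\<close>
  alone.\<close>

lemma comp_coeff_term:
  fixes b :: "nat \<Rightarrow> complex" and c :: complex
  assumes "p \<le> q" "c \<noteq> 0"
  shows "b k * of_nat ((n + (q - p) * k) choose (q * k)) * c ^ (n - p * k)
    = c ^ n * (fact (n + (q - p) * k) * rGamma (of_nat n - of_nat p * of_nat k + 1) * (b k / (fact (q * k) * (c ^ p) ^ k)))"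
proof (cases "p * k \<le> n")
  case True
  have 1: "of_nat (n + (q - p) * k) - of_nat (q * k) + 1 = (of_nat n - of_nat p * of_nat k + 1 :: complex)"
  proof -
    from assms obtain e where "q = p + e" using le_Suc_ex by blast
    then show ?thesis by (simp add: algebra_simps)
  qed
  have "c ^ (n - p * k) = c ^ n / (c ^ p) ^ k"
    using True assms by (simp add: power_diff power_mult)
  then show ?thesis
    unfolding binomial_rGamma 1 by (simp only: times_divide_eq_left times_divide_eq_right divide_divide_eq_left mult_ac)
next
  case False
  then have "n + (q - p) * k < q * k"
    using assms by (metis add_less_mono1 le_add_diff_inverse2 not_le add.commute add_mult_distrib)
  moreover have "rGamma (of_nat n - of_nat p * of_nat k + 1 :: complex) = 0"
    using rGamma_of_nat_diff[of n "p * k"] False by simp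
  ultimately show ?thesis by simp
qed

text \<open>Here \<open>g\<close> is the certificate: the ratio of the telescoping antidifference to the \<open>v\<close>-free part of
  the summand, normalised so that everything is polynomial.  The values of \<open>rGamma\<close> at the poles
  of \<open>Gamma\<close> cut off the sums, so no boundary terms need separate treatment.\<close>

lemma comp_coeff_recurrence:
  fixes g s :: "nat \<Rightarrow> nat \<Rightarrow> complex"
  assumes pq: "0 < p" "q = p + e" "c \<noteq> 0"
    and b: "\<And>k. b k / (fact (q * k) * (c ^ p) ^ k) = \<beta> k * v k"
    and g: "\<And>n. g n 0 = 0" "\<And>n k. g n (Suc k) * \<beta> (Suc k) = s n k * \<beta> k"
    and cert: "\<And>n k. (A n * (c\<^sup>2 * ((of_nat n + of_nat e * of_nat k + 1) * (of_nat n + of_nat e * of_nat k + 2)))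
        + B n * (c * ((of_nat n + of_nat e * of_nat k + 1) * (of_nat n + 2 - of_nat p * of_nat k)))
        + C n * ((of_nat n + 2 - of_nat p * of_nat k) * (of_nat n + 1 - of_nat p * of_nat k))) * v k
        = s n k * pochhammer (of_nat n + of_nat e * of_nat k + 1) e
            * pochhammer (of_nat n - of_nat p * of_nat k - of_nat p + 3) p - g n k"
  shows "A n * comp_coeff p q c b (n + 2) + B n * comp_coeff p q c b (n + 1) + C n * comp_coeff p q c b n = 0"
proof -
  \<comment> \<open>\<open>rGamma\<close> is shifted up by 2 relative to \<open>F\<close>, so that
    \<open>F\<close> at \<open>n\<close>, \<open>n + 1\<close> and \<open>n + 2\<close> are all
    polynomial multiples of \<open>v k * T n k\<close>.\<close>
  define T where "T = (\<lambda>n k. c ^ n * (fact (n + e * k) * rGamma (of_nat n - of_nat p * of_nat k + 3)) * \<beta> k)"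
  define G where "G = (\<lambda>n k. g n k * T n k)"
  define F where "F = (\<lambda>n k. c ^ n * (fact (n + e * k) * rGamma (of_nat n - of_nat p * of_nat k + 1)) * (\<beta> k * v k))"
  have F: "comp_coeff p q c b n = (\<Sum>k\<le>n. F n k)" for n
    unfolding comp_coeff_def F_def using pq b by (subst comp_coeff_term) (auto simp: mult_ac)
  have van: "rGamma (of_nat m - of_nat p * of_nat k + 1 :: complex) = 0" if "m < k" for m k
  proof -
    have "m < p * k" using that pq(1) by (metis less_le_trans mult_le_mono1 nat_mult_1 Suc_leI One_nat_def)
    from rGamma_of_nat_diff[OF this] show ?thesis by simp
  qed
  show ?thesis unfolding F
  proof (rule zeilberger_recurrence[where G = G])
    fix n k
    let ?x = "of_nat n :: complex" and ?y = "of_nat k :: complex"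
    define R where "R = rGamma (?x - of_nat p * ?y + 3)"
    have R2: "rGamma (?x - of_nat p * ?y + 2) = (?x + 2 - of_nat p * ?y) * R"
      unfolding R_def rGamma_down(1) by (simp add: algebra_simps)
    have R1: "rGamma (?x - of_nat p * ?y + 1) = (?x + 1 - of_nat p * ?y) * ((?x + 2 - of_nat p * ?y) * R)"
      unfolding R_def rGamma_down(2) by (simp add: algebra_simps)
    have f1: "fact (n + 1 + e * k) = (?x + of_nat e * ?y + 1) * (fact (n + e * k) :: complex)"
      by (simp add: algebra_simps)
    have f2: "fact (n + 2 + e * k) = (?x + of_nat e * ?y + 1) * (?x + of_nat e * ?y + 2) * (fact (n + e * k) :: complex)"
      by (simp add: algebra_simps)
    have "rGamma (of_nat (n + 2) - of_nat p * ?y + 1) = R"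
      "rGamma (of_nat (n + 1) - of_nat p * ?y + 1) = (?x + 2 - of_nat p * ?y) * R"
      unfolding R2[symmetric] by (simp_all add: R_def algebra_simps)
    note R = this R1
    have "F (n + 2) k = (c\<^sup>2 * ((?x + of_nat e * ?y + 1) * (?x + of_nat e * ?y + 2))) * v k * T n k"
      unfolding T_def F_def R f2 R_def[symmetric] power_add by (simp only: mult_ac)
    moreover have "F (n + 1) k = (c * ((?x + of_nat e * ?y + 1) * (?x + 2 - of_nat p * ?y))) * v k * T n k"
      unfolding T_def F_def R f1 R_def[symmetric] power_add power_one_right by (simp only: mult_ac)
    moreover have "F n k = ((?x + 2 - of_nat p * ?y) * (?x + 1 - of_nat p * ?y)) * v k * T n k"
      unfolding T_def F_def R R_def[symmetric] by (simp only: mult_ac)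
    moreover have "G n (Suc k) = s n k * pochhammer (?x + of_nat e * ?y + 1) e
            * pochhammer (?x - of_nat p * ?y - of_nat p + 3) p * T n k"
    proof -
      \<comment> \<open>Passing from \<open>k\<close> to \<open>k + 1\<close> lowers the argument of
        \<open>rGamma\<close> by \<open>p\<close> and raises that of the factorial by
        \<open>e\<close>; these are the two Pochhammer factors in \<open>cert\<close>.\<close>
      have "rGamma (?x - of_nat p * of_nat (Suc k) + 3) = pochhammer (?x - of_nat p * ?y - of_nat p + 3) p * R"
        using pochhammer_rGamma[of "?x - of_nat p * ?y - of_nat p + 3" p]
        by (simp add: R_def algebra_simps)
      moreover have "fact (n + e * Suc k) = pochhammer (?x + of_nat e * ?y + 1) e * fact (n + e * k)"
        using pochhammer_product'[of "1 :: complex" "n + e * k" e]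
        by (simp add: pochhammer_fact add_ac)
      ultimately have "G n (Suc k) = c ^ n * (pochhammer (?x + of_nat e * ?y + 1) e * fact (n + e * k)
          * (pochhammer (?x - of_nat p * ?y - of_nat p + 3) p * R)) * (g n (Suc k) * \<beta> (Suc k))"
        unfolding G_def T_def by (simp only: mult_ac)
      then show ?thesis
        unfolding g(2) T_def R_def by (simp only: mult_ac)
    qed
    ultimately show "A n * F (n + 2) k + B n * F (n + 1) k + C n * F n k = G n (Suc k) - G n k"
      using arg_cong[OF cert[of n k], of "\<lambda>x. x * T n k"] unfolding G_def
      by (simp only: distrib_right left_diff_distrib mult.assoc)
  next
    fix n
    \<comment> \<open>Since \<open>p\<close> is at least 1, the argument
      \<open>n - p (n + 3) + 3\<close> is a nonpositive integer, a zero of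
      \<open>rGamma\<close>.\<close>
    have "T n (n + 3) = 0"
      using van[of "n + 2" "n + 3"] unfolding T_def by (simp add: algebra_simps)
    then show "G n (n + 3) = 0" by (simp add: G_def)
  next
    fix n k :: nat assume "n < k"
    then show "F n k = 0" unfolding F_def by (simp add: van)
  qed (simp add: G_def g)
qed

lemma of_nat_Suc_neq_0: "1 + of_nat k \<noteq> (0 :: complex)"
  by (metis of_nat_Suc of_nat_neq_0)

lemma pochhammer_small:
  fixes a :: complex
  shows "pochhammer a 1 = a" "pochhammer a 2 = a * (a + 1)" "pochhammer a 3 = a * (a + 1) * (a + 2)"
  by (simp_all add: pochhammer_Suc numeral_2_eq_2 numeral_3_eq_3 add_ac)

section \<open>Recurrences of the Almkvist--Zudilin and Domb numbers\<close>

text \<open>Both recurrences are shifted by one from their usual form, for instance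
  \<open>(n+1)^3 u(n+1) + (2n+1)(7n^2+7n+3) u(n) + 81 n^3 u(n-1) = 0\<close>, so that no predecessor
  of \<open>n\<close> occurs.\<close>

abbreviation rec_A :: "nat \<Rightarrow> complex" where "rec_A n \<equiv> (of_nat n + 2) ^ 3"

abbreviation az_B :: "nat \<Rightarrow> complex" where
  "az_B n \<equiv> (2 * of_nat n + 3) * (7 * (of_nat n + 1)\<^sup>2 + 7 * (of_nat n + 1) + 3)"

abbreviation az_C :: "nat \<Rightarrow> complex" where "az_C n \<equiv> 81 * (of_nat n + 1) ^ 3"

abbreviation domb_B :: "nat \<Rightarrow> complex" where
  "domb_B n \<equiv> - (2 * (2 * of_nat n + 3) * (5 * (of_nat n + 1)\<^sup>2 + 5 * (of_nat n + 1) + 2))"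

abbreviation domb_C :: "nat \<Rightarrow> complex" where "domb_C n \<equiv> 64 * (of_nat n + 1) ^ 3"

definition quartic_coeff :: "nat \<Rightarrow> complex" where
  "quartic_coeff k = fact (4 * k) / fact k ^ 4"

text \<open>The product of \<open>(2k choose k)^2\<close> and \<open>3k choose k\<close>, after
  cancelling one \<open>(2k)!\<close>.\<close>

definition cubic_coeff :: "nat \<Rightarrow> complex" where
  "cubic_coeff k = fact (2 * k) * fact (3 * k) / fact k ^ 5"

text \<open>Counts closed walks of length \<open>2n\<close> on the honeycomb lattice;
  \<open>lattice_coeff\<close> below does so for the cubic lattice.\<close>

definition honeycomb :: "nat \<Rightarrow> complex" where
  "honeycomb n = (\<Sum>k\<le>n. of_nat (n choose k) ^ 2 * of_nat ((2 * k) choose k))"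

definition lattice_coeff :: "nat \<Rightarrow> complex" where
  "lattice_coeff k = of_nat ((2 * k) choose k) * honeycomb k"

definition domb :: "nat \<Rightarrow> complex" where
  "domb n = (\<Sum>k\<le>n. of_nat (n choose k) ^ 2 * of_nat ((2 * k) choose k) * of_nat ((2 * (n - k)) choose (n - k)))"

text \<open>The power \<open>k^4\<close> in \<open>g\<close> cancels the \<open>(k+1)^4\<close> from
  \<open>\<beta> (k+1) / \<beta> k\<close>, so that \<open>s\<close> is a polynomial; dividing by
  -27 gives its coefficients. Setting \<open>k = 0\<close> in the certificate equation, where
  \<open>g\<close> vanishes, determines the factor linear in \<open>n\<close>.\<close>

lemma quartic_1_recurrence:
  "rec_A n * comp_coeff 1 4 (-27) quartic_coeff (n + 2) + az_B n * comp_coeff 1 4 (-27) quartic_coeff (n + 1)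
    + az_C n * comp_coeff 1 4 (-27) quartic_coeff n = 0"
proof (rule comp_coeff_recurrence[where e = 3 and \<beta> = "\<lambda>k. 1 / (fact k ^ 4 * (-27) ^ k)" and v = "\<lambda>k. 1"
    and g = "\<lambda>n k. of_nat k ^ 4 * (-20412 - 11664 * of_nat n)" and s = "\<lambda>n k. (756 + 432 * of_nat n)"])
  fix n k
  define x y :: complex where "x = of_nat n" and "y = of_nat k"
  show "(rec_A n * ((-27)\<^sup>2 * ((of_nat n + of_nat 3 * of_nat k + 1) * (of_nat n + of_nat 3 * of_nat k + 2)))
      + az_B n * ((-27) * ((of_nat n + of_nat 3 * of_nat k + 1) * (of_nat n + 2 - of_nat 1 * of_nat k)))
      + az_C n * ((of_nat n + 2 - of_nat 1 * of_nat k) * (of_nat n + 1 - of_nat 1 * of_nat k))) * 1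
      = (756 + 432 * of_nat n) * pochhammer (of_nat n + of_nat 3 * of_nat k + 1) 3
            * pochhammer (of_nat n - of_nat 1 * of_nat k - of_nat 1 + 3) 1 - of_nat k ^ 4 * (-20412 - 11664 * of_nat n)"
    unfolding x_def[symmetric] y_def[symmetric] pochhammer_small of_nat_numeral of_nat_1 by algebra
qed (simp_all add: quartic_coeff_def power_mult_distrib of_nat_Suc_neq_0, simp add: field_simps)

text \<open>Here \<open>comp_coeff\<close> is the classical sum of
  \<open>(-1)^(n-k) 3^(n-3k) (3k)!/k!^3 (n choose 3k) (n+k choose k)\<close> for the
  Almkvist--Zudilin numbers.\<close>

lemma quartic_3_recurrence:
  "rec_A n * comp_coeff 3 4 (-3) quartic_coeff (n + 2) + az_B n * comp_coeff 3 4 (-3) quartic_coeff (n + 1)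
    + az_C n * comp_coeff 3 4 (-3) quartic_coeff n = 0"
proof (rule comp_coeff_recurrence[where e = 1 and \<beta> = "\<lambda>k. 1 / (fact k ^ 4 * (-27) ^ k)" and v = "\<lambda>k. 1"
    and g = "\<lambda>n k. of_nat k ^ 4 * (-1620 - 1296 * of_nat n)" and s = "\<lambda>n k. (60 + 48 * of_nat n)"])
  fix n k
  define x y :: complex where "x = of_nat n" and "y = of_nat k"
  show "(rec_A n * ((-3)\<^sup>2 * ((of_nat n + of_nat 1 * of_nat k + 1) * (of_nat n + of_nat 1 * of_nat k + 2)))
      + az_B n * ((-3) * ((of_nat n + of_nat 1 * of_nat k + 1) * (of_nat n + 2 - of_nat 3 * of_nat k)))
      + az_C n * ((of_nat n + 2 - of_nat 3 * of_nat k) * (of_nat n + 1 - of_nat 3 * of_nat k))) * 1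
      = (60 + 48 * of_nat n) * pochhammer (of_nat n + of_nat 1 * of_nat k + 1) 1
            * pochhammer (of_nat n - of_nat 3 * of_nat k - of_nat 3 + 3) 3 - of_nat k ^ 4 * (-1620 - 1296 * of_nat n)"
    unfolding x_def[symmetric] y_def[symmetric] pochhammer_small of_nat_numeral of_nat_1 by algebra
qed (simp_all add: quartic_coeff_def power_mult_distrib of_nat_Suc_neq_0, simp add: field_simps)

text \<open>Now \<open>\<beta> (k+1) / \<beta> k = (2k+1) / (8 (k+1)^4)\<close>, which explains the
  factor \<open>2k + 1\<close> in \<open>s\<close> and the ratio 8 between the constants of
  \<open>g\<close> and \<open>s\<close>.\<close>

lemma cubic_2_recurrence:
  "rec_A n * comp_coeff 2 3 4 cubic_coeff (n + 2) + domb_B n * comp_coeff 2 3 4 cubic_coeff (n + 1)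
    + domb_C n * comp_coeff 2 3 4 cubic_coeff n = 0"
proof (rule comp_coeff_recurrence[where e = 1 and \<beta> = "\<lambda>k. fact (2 * k) / (fact k ^ 5 * 16 ^ k)" and v = "\<lambda>k. 1"
    and g = "\<lambda>n k. of_nat k ^ 4 * (-768 - 576 * of_nat n)" and s = "\<lambda>n k. ((2 * of_nat k + 1) * (-96 - 72 * of_nat n))"])
  fix n k
  define x y :: complex where "x = of_nat n" and "y = of_nat k"
  show "(rec_A n * (4\<^sup>2 * ((of_nat n + of_nat 1 * of_nat k + 1) * (of_nat n + of_nat 1 * of_nat k + 2)))
      + domb_B n * (4 * ((of_nat n + of_nat 1 * of_nat k + 1) * (of_nat n + 2 - of_nat 2 * of_nat k)))
      + domb_C n * ((of_nat n + 2 - of_nat 2 * of_nat k) * (of_nat n + 1 - of_nat 2 * of_nat k))) * 1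
      = ((2 * of_nat k + 1) * (-96 - 72 * of_nat n)) * pochhammer (of_nat n + of_nat 1 * of_nat k + 1) 1
            * pochhammer (of_nat n - of_nat 2 * of_nat k - of_nat 2 + 3) 2 - of_nat k ^ 4 * (-768 - 576 * of_nat n)"
    unfolding x_def[symmetric] y_def[symmetric] pochhammer_small of_nat_numeral of_nat_1 by algebra
next
  fix n k
  define y :: complex where "y = of_nat k"
  have y: "y + 1 \<noteq> 0" using of_nat_Suc_neq_0[of k] by (simp add: y_def add.commute)
  have f: "fact (2 * Suc k) = (2 * y + 2) * (2 * y + 1) * (fact (2 * k) :: complex)"
    "fact (Suc k) = (y + 1) * (fact k :: complex)"
    by (simp_all add: y_def algebra_simps)
  show "of_nat (Suc k) ^ 4 * (-768 - 576 * of_nat n) * ((fact (2 * Suc k) :: complex) / (fact (Suc k) ^ 5 * 16 ^ Suc k)) = ((2 * of_nat k + 1) * (-96 - 72 * of_nat n)) * (fact (2 * k) / (fact k ^ 5 * 16 ^ k))"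
    unfolding f of_nat_Suc y_def[symmetric] using y
    by (simp add: divide_simps add.commute[of 1]) algebra
qed (simp_all add: cubic_coeff_def field_simps)

text \<open>The sign \<open>(-1)^k\<close> is absorbed in \<open>(-16)^k\<close>; apart from that
  the certificate has the shape of the one in \<open>cubic_2_recurrence\<close>, with -8 in place of
  8.\<close>

lemma cubic_1_recurrence:
  "rec_A n * comp_coeff 1 3 16 (\<lambda>k. (-1) ^ k * cubic_coeff k) (n + 2) + domb_B n * comp_coeff 1 3 16 (\<lambda>k. (-1) ^ k * cubic_coeff k) (n + 1)
    + domb_C n * comp_coeff 1 3 16 (\<lambda>k. (-1) ^ k * cubic_coeff k) n = 0"
proof (rule comp_coeff_recurrence[where e = 2 and \<beta> = "\<lambda>k. fact (2 * k) / (fact k ^ 5 * (-16) ^ k)" and v = "\<lambda>k. 1"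
    and g = "\<lambda>n k. of_nat k ^ 4 * (-3840 - 2304 * of_nat n)" and s = "\<lambda>n k. ((2 * of_nat k + 1) * (480 + 288 * of_nat n))"])
  fix n k
  define x y :: complex where "x = of_nat n" and "y = of_nat k"
  show "(rec_A n * (16\<^sup>2 * ((of_nat n + of_nat 2 * of_nat k + 1) * (of_nat n + of_nat 2 * of_nat k + 2)))
      + domb_B n * (16 * ((of_nat n + of_nat 2 * of_nat k + 1) * (of_nat n + 2 - of_nat 1 * of_nat k)))
      + domb_C n * ((of_nat n + 2 - of_nat 1 * of_nat k) * (of_nat n + 1 - of_nat 1 * of_nat k))) * 1
      = ((2 * of_nat k + 1) * (480 + 288 * of_nat n)) * pochhammer (of_nat n + of_nat 2 * of_nat k + 1) 2
            * pochhammer (of_nat n - of_nat 1 * of_nat k - of_nat 1 + 3) 1 - of_nat k ^ 4 * (-3840 - 2304 * of_nat n)"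
    unfolding x_def[symmetric] y_def[symmetric] pochhammer_small of_nat_numeral of_nat_1 by algebra
next
  fix n k
  define y :: complex where "y = of_nat k"
  have y: "y + 1 \<noteq> 0" using of_nat_Suc_neq_0[of k] by (simp add: y_def add.commute)
  have f: "fact (2 * Suc k) = (2 * y + 2) * (2 * y + 1) * (fact (2 * k) :: complex)"
    "fact (Suc k) = (y + 1) * (fact k :: complex)"
    by (simp_all add: y_def algebra_simps)
  show "of_nat (Suc k) ^ 4 * (-3840 - 2304 * of_nat n) * ((fact (2 * Suc k) :: complex) / (fact (Suc k) ^ 5 * (-16) ^ Suc k)) = ((2 * of_nat k + 1) * (480 + 288 * of_nat n)) * (fact (2 * k) / (fact k ^ 5 * (-16) ^ k))"
    unfolding f of_nat_Suc y_def[symmetric] using y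
    by (simp add: divide_simps add.commute[of 1]) algebra
qed (simp_all add: cubic_coeff_def field_simps, simp flip: power_mult_distrib)


section \<open>Recurrences of the honeycomb, cubic lattice and Domb numbers\<close>

lemma central_binomial_complex: "of_nat ((2 * k) choose k) = fact (2 * k) / (fact k)\<^sup>2 * (1 :: complex)"
  by (simp add: binomial_fact power2_eq_square mult_2)

lemma honeycomb_recurrence_aux:
  "(of_nat n + 2)\<^sup>2 * honeycomb (n + 2) + (- (10 * (of_nat n + 1)\<^sup>2 + 10 * (of_nat n + 1) + 3)) * honeycomb (n + 1)
    + 9 * (of_nat n + 1)\<^sup>2 * honeycomb n = 0"
proof -
  define F where "F = (\<lambda>n k. (fact n)\<^sup>2 * (rGamma (of_nat n - of_nat k + 1 :: complex))\<^sup>2 * (fact (2 * k) / fact k ^ 4))"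
  define T where "T = (\<lambda>n k. (fact n)\<^sup>2 * (rGamma (of_nat n - of_nat k + 3 :: complex))\<^sup>2 * (fact (2 * k) / fact k ^ 4))"
  \<comment> \<open>A certificate in the sense of Zeilberger's algorithm, verified below by
    \<open>algebra\<close>. The cube \<open>k^3\<close> in \<open>G\<close> cancels the denominator
    left in \<open>(2k+2)(2k+1) / (k+1)^4\<close>.\<close>
  define q where "q = (\<lambda>x y :: complex. - 8 + 3 * y - 20 * x + 6 * x * y - 16 * x\<^sup>2 + 3 * x\<^sup>2 * y - 4 * x ^ 3)"
  define G where "G = (\<lambda>n k. of_nat k ^ 3 * q (of_nat n) (of_nat k) * T n k)"
  have F: "honeycomb n = (\<Sum>k\<le>n. F n k)" for n
    unfolding honeycomb_def F_def
    unfolding binomial_rGamma[of n] central_binomial_complex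
    by (intro sum.cong refl) (simp add: power_divide power_mult_distrib flip: power_add)
  show ?thesis unfolding F
  proof (rule zeilberger_recurrence[where G = G])
    fix n k
    define x y :: complex where "x = of_nat n" and "y = of_nat k"
    have y: "y + 1 \<noteq> 0" using of_nat_Suc_neq_0[of k] by (simp add: y_def add.commute)
    define R where "R = rGamma (x - y + 3)"
    define W :: complex where "W = (fact n)\<^sup>2 * (fact (2 * k) / fact k ^ 4)"
    have R: "rGamma (of_nat (n + 2) - of_nat k + 1) = R"
      "rGamma (of_nat (n + 1) - of_nat k + 1) = (x - y + 2) * R"
      "rGamma (of_nat n - of_nat k + 1) = (x - y + 1) * ((x - y + 2) * R)"
      "rGamma (of_nat n - of_nat (Suc k) + 3) = (x - y + 2) * R"
      unfolding R_def rGamma_down(2)[symmetric] unfolding rGamma_down(1)[symmetric] by (simp_all add: x_def y_def algebra_simps)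
    have f: "fact (n + 1) = (x + 1) * (fact n :: complex)" "fact (n + 2) = (x + 2) * (x + 1) * (fact n :: complex)"
      "fact (2 * Suc k) = (2 * y + 2) * (2 * y + 1) * (fact (2 * k) :: complex)"
      "fact (Suc k) = (y + 1) * (fact k :: complex)"
      by (simp_all add: x_def y_def algebra_simps)
    have "F (n + 2) k = (x + 1)\<^sup>2 * (x + 2)\<^sup>2 * (R\<^sup>2 * W)" "F (n + 1) k = (x + 1)\<^sup>2 * (x + 2 - y)\<^sup>2 * (R\<^sup>2 * W)"
      "F n k = (x + 2 - y)\<^sup>2 * (x + 1 - y)\<^sup>2 * (R\<^sup>2 * W)"
      unfolding F_def R f W_def by algebra+
    moreover have "G n k = y ^ 3 * q x y * (R\<^sup>2 * W)"
      unfolding G_def T_def W_def R_def x_def y_def by (simp only: mult_ac)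
    moreover have "G n (Suc k) = 2 * (2 * y + 1) * (x + 2 - y)\<^sup>2 * q x (y + 1) * (R\<^sup>2 * W)"
      unfolding G_def T_def W_def R f unfolding of_nat_Suc x_def[symmetric] y_def[symmetric] add.commute[of 1 y]
      using y by (simp add: divide_simps) algebra
    ultimately show "(of_nat n + 2)\<^sup>2 * F (n + 2) k + - (10 * (of_nat n + 1)\<^sup>2 + 10 * (of_nat n + 1) + 3) * F (n + 1) k
        + 9 * (of_nat n + 1)\<^sup>2 * F n k = G n (Suc k) - G n k"
      unfolding x_def[symmetric] q_def by algebra
  next
    fix n k :: nat assume "n < k"
    then show "F n k = 0" by (simp add: F_def rGamma_of_nat_diff)
  next
    fix n
    have "rGamma (of_nat n - of_nat (n + 3) + 3 :: complex) = 0"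
      by simp
    then show "G n (n + 3) = 0" by (simp add: G_def T_def)
  qed (simp add: G_def)
qed

text \<open>Lowering the index by one gives the form that eliminates
  \<open>honeycomb (Suc k)\<close>; the case \<open>k = 0\<close> is just
  \<open>honeycomb 1 = 3 * honeycomb 0\<close>.\<close>

lemma honeycomb_recurrence:
  "(of_nat k + 1)\<^sup>2 * honeycomb (Suc k)
    = (10 * (of_nat k)\<^sup>2 + 10 * of_nat k + 3) * honeycomb k - 9 * (of_nat k)\<^sup>2 * honeycomb (k - 1)"
proof (cases k)
  case 0
  then show ?thesis by (simp add: honeycomb_def)
next
  case (Suc m)
  then show ?thesis using honeycomb_recurrence_aux[of m]
    by (simp add: algebra_simps)
qed

text \<open>The summand is not hypergeometric; its certificate therefore involves both \<open>honeycomb k\<close> and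
  \<open>honeycomb (k - 1)\<close>, and at \<open>k = 0\<close> the truncated \<open>k - 1\<close> is multiplied by \<open>0\<close>.\<close>

lemma lattice_recurrence:
  "rec_A n * comp_coeff 1 2 (-9) lattice_coeff (n + 2)
    + az_B n * comp_coeff 1 2 (-9) lattice_coeff (n + 1)
    + az_C n * comp_coeff 1 2 (-9) lattice_coeff n = 0"
proof (rule comp_coeff_recurrence[where e = 1 and \<beta> = "\<lambda>k. 1 / ((fact k)\<^sup>2 * (-9) ^ k)" and v = honeycomb
    and g = "\<lambda>n k. (-486 - 324 * of_nat n) * (of_nat k)\<^sup>2 * ((of_nat k)\<^sup>2 * honeycomb k
       + (of_nat n + of_nat k + 1) * (of_nat n + 2 - of_nat k) * honeycomb (k - 1))"
    and s = "\<lambda>n k. (54 + 36 * of_nat n) * ((10 * (of_nat k)\<^sup>2 + 10 * of_nat k + 3) * honeycomb k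
       - 9 * (of_nat k)\<^sup>2 * honeycomb (k - 1) + (of_nat n + of_nat k + 2) * (of_nat n + 1 - of_nat k) * honeycomb k)"])
  fix n k
  define x y :: complex where "x = of_nat n" and "y = of_nat k"
  have y: "y + 1 \<noteq> 0" using of_nat_Suc_neq_0[of k] by (simp add: y_def add.commute)
  \<comment> \<open>Linear in \<open>honeycomb k\<close> and \<open>honeycomb (k - 1)\<close>, which
    are treated as independent: the coefficients of both agree as polynomials in \<open>n\<close>
    and \<open>k\<close>.\<close>
  show "(rec_A n * ((-9)\<^sup>2 * ((of_nat n + of_nat 1 * of_nat k + 1) * (of_nat n + of_nat 1 * of_nat k + 2)))
      + az_B n * (- 9 * ((of_nat n + of_nat 1 * of_nat k + 1) * (of_nat n + 2 - of_nat 1 * of_nat k)))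
      + az_C n * ((of_nat n + 2 - of_nat 1 * of_nat k) * (of_nat n + 1 - of_nat 1 * of_nat k))) * honeycomb k
      = (54 + 36 * of_nat n) * ((10 * (of_nat k)\<^sup>2 + 10 * of_nat k + 3) * honeycomb k
       - 9 * (of_nat k)\<^sup>2 * honeycomb (k - 1) + (of_nat n + of_nat k + 2) * (of_nat n + 1 - of_nat k) * honeycomb k)
          * pochhammer (of_nat n + of_nat 1 * of_nat k + 1) 1
            * pochhammer (of_nat n - of_nat 1 * of_nat k - of_nat 1 + 3) 1
        - (-486 - 324 * of_nat n) * (of_nat k)\<^sup>2 * ((of_nat k)\<^sup>2 * honeycomb k
       + (of_nat n + of_nat k + 1) * (of_nat n + 2 - of_nat k) * honeycomb (k - 1))"
    unfolding x_def[symmetric] y_def[symmetric] pochhammer_small of_nat_numeral of_nat_1 by algebra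
  \<comment> \<open>This eliminates \<open>honeycomb (Suc k)\<close> from
    \<open>g n (Suc k)\<close>, which is how the shape of \<open>s\<close> arises.\<close>
  have h: "(y + 1)\<^sup>2 * honeycomb (Suc k) = (10 * y\<^sup>2 + 10 * y + 3) * honeycomb k - 9 * y\<^sup>2 * honeycomb (k - 1)"
    unfolding y_def by (rule honeycomb_recurrence)
  have f: "fact (Suc k) = (y + 1) * (fact k :: complex)"
    by (simp add: y_def)
  have "(-486 - 324 * x) * (y + 1)\<^sup>2 * ((y + 1)\<^sup>2 * honeycomb (Suc k)
       + (x + (y + 1) + 1) * (x + 2 - (y + 1)) * honeycomb k) * (1 / (((y + 1) * fact k)\<^sup>2 * (-9) ^ Suc k))
    = (54 + 36 * x) * ((10 * y\<^sup>2 + 10 * y + 3) * honeycomb k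
       - 9 * y\<^sup>2 * honeycomb (k - 1) + (x + y + 2) * (x + 1 - y) * honeycomb k) * (1 / ((fact k)\<^sup>2 * (-9) ^ k))"
    unfolding h using y by (simp add: divide_simps) algebra
  then show "(-486 - 324 * of_nat n) * (of_nat (Suc k))\<^sup>2 * ((of_nat (Suc k))\<^sup>2 * honeycomb (Suc k)
       + (of_nat n + of_nat (Suc k) + 1) * (of_nat n + 2 - of_nat (Suc k)) * honeycomb (Suc k - 1)) * (1 / ((fact (Suc k))\<^sup>2 * (-9) ^ Suc k))
    = (54 + 36 * of_nat n) * ((10 * (of_nat k)\<^sup>2 + 10 * of_nat k + 3) * honeycomb k
       - 9 * (of_nat k)\<^sup>2 * honeycomb (k - 1) + (of_nat n + of_nat k + 2) * (of_nat n + 1 - of_nat k) * honeycomb k) * (1 / ((fact k)\<^sup>2 * (-9) ^ k))"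
    unfolding f of_nat_Suc x_def[symmetric] y_def[symmetric] add.commute[of 1 y] by (simp only: diff_Suc_1)
qed (simp_all add: lattice_coeff_def binomial_fact power2_eq_square)

text \<open>Half-integers are never poles of \<open>Gamma\<close>, so the shift holds for negative
  \<open>m\<close> as well; \<open>domb_recurrence\<close> needs it at \<open>n - k\<close> with
  \<open>k > n\<close>.\<close>

lemma Gamma_half_shift:
  "Gamma (of_int m + 3 / 2 :: complex) = (of_int m + 1 / 2) * Gamma (of_int m + 1 / 2)"
proof -
  have "of_int m + 1 / 2 \<noteq> - (of_nat j :: complex)" for j
  proof
    assume A: "of_int m + 1 / 2 = - (of_nat j :: complex)"
    have "of_int (2 * m + 1 + 2 * int j) = 2 * ((of_int m + 1 / 2) + of_nat j :: complex)"
      by simp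
    also have "\<dots> = 0" unfolding A by simp
    finally have "of_int (2 * m + 1 + 2 * int j) = (0 :: complex)" .
    then show False by (simp only: of_int_eq_0_iff) presburger
  qed
  then have "of_int m + 1 / 2 \<notin> (\<int>\<^sub>\<le>\<^sub>0 :: complex set)"
    by (metis nonpos_Ints_cases')
  from Gamma_plus1[OF this] show ?thesis by (simp add: add.assoc)
qed

text \<open>The right-hand side interpolates the central binomials and, unlike
  \<open>(2m choose m)\<close> with a truncated \<open>m = n - k\<close>, keeps its recurrence at
  negative arguments.\<close>

lemma central_binomial_Gamma:
  "of_nat ((2 * m) choose m) * fact m = 4 ^ m * Gamma (of_nat m + 1 / 2) / Gamma (1 / 2 :: complex)"
proof (induction m)
  case (Suc m)
  have 1: "of_nat ((2 * Suc m) choose Suc m) * fact (Suc m) = (4 * of_nat m + 2) * (of_nat ((2 * m) choose m) * fact m :: complex)"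
  proof -
    have f: "fact (2 * Suc m) = (2 * of_nat m + 2) * (2 * of_nat m + 1) * (fact (2 * m) :: complex)"
      "fact (Suc m) = (of_nat m + 1) * (fact m :: complex)"
      by (simp_all add: algebra_simps)
    have "of_nat m + 1 \<noteq> (0 :: complex)" using of_nat_Suc_neq_0[of m] by (simp add: add.commute)
    then show ?thesis
      unfolding central_binomial_complex f by (simp add: divide_simps) algebra
  qed
  define g where "g = Gamma (of_nat m + 1 / 2 :: complex)"
  have 2: "Gamma (of_nat (Suc m) + 1 / 2 :: complex) = (of_nat m + 1 / 2) * g"
    using Gamma_half_shift[of "int m"] by (simp add: g_def add.commute add.left_commute)
  show ?case unfolding 1 2 Suc.IH g_def[symmetric] by (simp add: divide_simps)
qed (simp add: Gamma_one_half_complex)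

lemma domb_recurrence:
  "rec_A n * domb (n + 2) + domb_B n * domb (n + 1) + domb_C n * domb n = 0"
proof -
  define H :: "complex \<Rightarrow> complex" where "H = (\<lambda>z. Gamma (z + 1 / 2) / Gamma (1 / 2))"
  \<comment> \<open>The third \<open>rGamma\<close> factor, beyond the square of
    \<open>n choose k\<close>, comes from
    \<open>2(n-k) choose (n-k) = 4^(n-k) H(n-k) / (n-k)!\<close>.\<close>
  define F where "F = (\<lambda>n k. (fact n)\<^sup>2 * (rGamma (of_nat n - of_nat k + 1 :: complex)) ^ 3 * (4 ^ n / 4 ^ k)
    * H (of_nat n - of_nat k) * (fact (2 * k) / fact k ^ 4))"
  define T where "T = (\<lambda>n k. (fact n)\<^sup>2 * (rGamma (of_nat n - of_nat k + 3 :: complex)) ^ 3 * (4 ^ n / 4 ^ k)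
    * H (of_nat n - of_nat k) * (fact (2 * k) / fact k ^ 4))"
  define q where "q = (\<lambda>x y :: complex. - 224 + 296 * y - 120 * y ^ 2 + 16 * y ^ 3 - 864 * x + 948 * x * y - 312 * x * y ^ 2 + 32 * x * y ^ 3 - 1304 * x ^ 2 + 1112 * x ^ 2 * y - 264 * x ^ 2 * y ^ 2 + 16 * x ^ 2 * y ^ 3 - 960 * x ^ 3 + 564 * x ^ 3 * y - 72 * x ^ 3 * y ^ 2 - 344 * x ^ 4 + 104 * x ^ 4 * y - 48 * x ^ 5)"
  \<comment> \<open>At \<open>k + 1\<close> the factor \<open>2(n - k) + 1\<close> becomes
    \<open>2(n - k) - 1\<close>, twice the ratio of \<open>H (n - k)\<close> to
    \<open>H (n - k - 1)\<close>; thus \<open>G n (Suc k)\<close> is again a multiple of the common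
    factor \<open>Z\<close>.\<close>
  define G where "G = (\<lambda>n k. of_nat k ^ 3 * (2 * (of_nat n - of_nat k) + 1) * q (of_nat n) (of_nat k) * T n k)"
  have H: "H (of_int m + 1) = (of_int m + 1 / 2) * H (of_int m)" for m
    using Gamma_half_shift[of m] by (simp add: H_def algebra_simps)
  have F: "domb n = (\<Sum>k\<le>n. F n k)" for n
    unfolding domb_def
  proof (intro sum.cong refl)
    fix k assume "k \<in> {..n}"
    then have k: "k \<le> n" by simp
    then have "fact (n - k) * rGamma (of_nat n - of_nat k + 1 :: complex) = 1"
      using Gamma_fact[of "n - k", where 'a = complex]
      by (simp add: rGamma_inverse_Gamma of_nat_diff add.commute)
    then have "(of_nat ((2 * (n - k)) choose (n - k)) :: complex)
        = (of_nat ((2 * (n - k)) choose (n - k)) * fact (n - k)) * rGamma (of_nat n - of_nat k + 1)"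
      by (simp add: mult.assoc)
    also have "\<dots> = 4 ^ n / 4 ^ k * H (of_nat n - of_nat k) * rGamma (of_nat n - of_nat k + 1)"
      unfolding central_binomial_Gamma using k by (simp add: H_def of_nat_diff power_diff)
    finally have E: "of_nat ((2 * (n - k)) choose (n - k)) = 4 ^ n / 4 ^ k * H (of_nat n - of_nat k) * rGamma (of_nat n - of_nat k + 1)" .
    show "(of_nat (n choose k))\<^sup>2 * of_nat ((2 * k) choose k) * of_nat ((2 * (n - k)) choose (n - k)) = F n k"
      unfolding E binomial_rGamma[of n] central_binomial_complex[of k] F_def
      by (simp add: power_divide power_mult_distrib power2_eq_square power3_eq_cube power4_eq_xxxx mult_ac)
  qed
  show ?thesis unfolding F
  proof (rule zeilberger_recurrence[where G = G])
    fix n k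
    define x y :: complex where "x = of_nat n" and "y = of_nat k"
    have y: "y + 1 \<noteq> 0" using of_nat_Suc_neq_0[of k] by (simp add: y_def add.commute)
    define R where "R = rGamma (x - y + 3)"
    \<comment> \<open>\<open>H\<close> gains linear factors going up, \<open>rGamma\<close> going
      down; hence the lowest argument of \<open>H\<close> and the highest of \<open>rGamma\<close>
      serve as common factors.\<close>
    define h where "h = H (x - y - 1)"
    define W :: complex where "W = (fact n)\<^sup>2 * (4 ^ n / 4 ^ k) * (fact (2 * k) / fact k ^ 4)"
    have R: "rGamma (of_nat (n + 2) - of_nat k + 1) = R"
      "rGamma (of_nat (n + 1) - of_nat k + 1) = (x - y + 2) * R"
      "rGamma (of_nat n - of_nat k + 1) = (x - y + 1) * ((x - y + 2) * R)"
      "rGamma (of_nat n - of_nat (Suc k) + 3) = (x - y + 2) * R"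
      unfolding R_def rGamma_down(2)[symmetric] unfolding rGamma_down(1)[symmetric] by (simp_all add: x_def y_def algebra_simps)
    have h1: "H (x - y) = (x - y - 1 / 2) * h"
      using H[of "int n - int k - 1"] by (simp add: x_def y_def h_def)
    have h2: "H (x - y + 1) = (x - y + 1 / 2) * ((x - y - 1 / 2) * h)"
      using H[of "int n - int k"] unfolding h1[symmetric] by (simp add: x_def y_def)
    have h3: "H (x - y + 2) = (x - y + 3 / 2) * ((x - y + 1 / 2) * ((x - y - 1 / 2) * h))"
      using H[of "int n - int k + 1"] unfolding h2[symmetric] by (simp add: x_def y_def add.assoc)
    have xy: "of_nat n - of_nat k = x - y" "of_nat n - of_nat (Suc k) = x - y - 1"
      "of_nat (n + 1) - of_nat k = x - y + 1" "of_nat (n + 2) - of_nat k = x - y + 2"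
      by (simp_all add: x_def y_def)
    have h: "H (of_nat n - of_nat k) = (x - y - 1 / 2) * h" "H (of_nat n - of_nat (Suc k)) = h"
      "H (of_nat (n + 1) - of_nat k) = (x - y + 1 / 2) * ((x - y - 1 / 2) * h)"
      "H (of_nat (n + 2) - of_nat k) = (x - y + 3 / 2) * ((x - y + 1 / 2) * ((x - y - 1 / 2) * h))"
      unfolding xy h1 h2 h3 by (simp_all only: h_def)
    have f: "fact (n + 1) = (x + 1) * (fact n :: complex)" "fact (n + 2) = (x + 2) * (x + 1) * (fact n :: complex)"
      "fact (2 * Suc k) = (2 * y + 2) * (2 * y + 1) * (fact (2 * k) :: complex)"
      "fact (Suc k) = (y + 1) * (fact k :: complex)" "(4 :: complex) ^ (n + 2) = 16 * 4 ^ n"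
      "(4 :: complex) ^ (n + 1) = 4 * 4 ^ n" "(4 :: complex) ^ Suc k = 4 * 4 ^ k"
      by (simp_all add: x_def y_def algebra_simps)
    define Z where "Z = R ^ 3 * ((x - y - 1 / 2) * h) * W"
    have 1: "F (n + 2) k = 4 * (x + 1)\<^sup>2 * (x + 2)\<^sup>2 * (2 * (x - y) + 1) * (2 * (x - y) + 3) * Z"
      "F (n + 1) k = 2 * (x + 1)\<^sup>2 * (x + 2 - y) ^ 3 * (2 * (x - y) + 1) * Z"
      "F n k = ((x + 2 - y) * (x + 1 - y)) ^ 3 * Z"
      unfolding F_def R h f W_def Z_def by (simp_all only: power_mult_distrib) algebra+
    have 2: "G n k = y ^ 3 * (2 * (x - y) + 1) * q x y * Z"
      unfolding G_def T_def W_def h Z_def R_def x_def[symmetric] y_def[symmetric] h1 by (simp only: mult_ac)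
    have 3: "G n (Suc k) = (2 * y + 1) * (x + 2 - y) ^ 3 * q x (y + 1) * Z"
      unfolding G_def T_def W_def R f h Z_def unfolding of_nat_Suc x_def[symmetric] y_def[symmetric] add.commute[of 1 y]
      using y by (simp add: divide_simps) algebra
    show "rec_A n * F (n + 2) k + domb_B n * F (n + 1) k + domb_C n * F n k = G n (Suc k) - G n k"
      unfolding 1 2 3 x_def[symmetric] q_def by algebra
  next
    fix n k :: nat assume "n < k"
    then show "F n k = 0" by (simp add: F_def rGamma_of_nat_diff)
  next
    fix n
    have "rGamma (of_nat n - of_nat (n + 3) + 3 :: complex) = 0"
      by simp
    then show "G n (n + 3) = 0" by (simp add: G_def T_def)
  qed (simp add: G_def)
qed

section \<open>Equality of the transformed sequences from recurrences and two initial values\<close>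

lemma of_nat_plus_2_neq_0: "(of_nat n + 2) ^ 3 \<noteq> (0 :: complex)"
  using of_nat_neq_0[of "n + 1", where 'a = complex] by (simp add: add.commute add.assoc)

lemma quartic_1_eq_quartic_3:
  "comp_coeff 1 4 (-27) quartic_coeff n = comp_coeff 3 4 (-3) quartic_coeff n"
  by (rule recurrence_unique[OF quartic_1_recurrence quartic_3_recurrence of_nat_plus_2_neq_0])
    (simp_all add: comp_coeff_def quartic_coeff_def fact_numeral numeral_2_eq_2[symmetric] binomial_eq_0)

lemma lattice_eq_quartic_3:
  "comp_coeff 1 2 (-9) lattice_coeff n = comp_coeff 3 4 (-3) quartic_coeff n"
  by (rule recurrence_unique[OF lattice_recurrence quartic_3_recurrence of_nat_plus_2_neq_0])
    (simp_all add: comp_coeff_def quartic_coeff_def lattice_coeff_def honeycomb_def fact_numeral numeral_2_eq_2[symmetric] binomial_eq_0)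

lemma cubic_1_eq_domb:
  "comp_coeff 1 3 16 (\<lambda>k. (-1) ^ k * cubic_coeff k) n = domb n"
  by (rule recurrence_unique[OF cubic_1_recurrence domb_recurrence of_nat_plus_2_neq_0])
    (simp_all add: comp_coeff_def cubic_coeff_def domb_def fact_numeral numeral_2_eq_2[symmetric] binomial_eq_0)

lemma cubic_2_eq_domb:
  "comp_coeff 2 3 4 cubic_coeff n = domb n"
  by (rule recurrence_unique[OF cubic_2_recurrence domb_recurrence of_nat_plus_2_neq_0])
    (simp_all add: comp_coeff_def cubic_coeff_def domb_def fact_numeral numeral_2_eq_2[symmetric] binomial_eq_0)

section \<open>Pullbacks of logarithmic generating functions\<close>

text \<open>Division by zero gives 0 at \<open>n = 0\<close>, so the series effectively starts at
  \<open>n = 1\<close>.\<close>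

definition log_fps :: "(nat \<Rightarrow> complex) \<Rightarrow> complex fps" where
  "log_fps b = Abs_fps (\<lambda>n. b n / of_nat n)"

text \<open>The \<open>k\<close>-th term of the product is
  \<open>b k * X^(pk) / (1 - cX)^(qk+1)\<close>, expanded by the negative binomial series.\<close>

lemma comp_coeff_fps:
  assumes "p \<le> q" "0 < p"
  shows "fps_compose (Abs_fps b) (fps_X ^ p * inverse (1 - fps_const c * fps_X) ^ q) * inverse (1 - fps_const c * fps_X)
    = Abs_fps (comp_coeff p q c b)"
proof (rule fps_ext)
  fix n
  define v where "v = inverse (1 - fps_const c * fps_X)"
  define S where "S = fps_X ^ p * v ^ q"
  have S0: "fps_nth S 0 = 0"
    using assms by (simp add: S_def fps_mult_nth)
  \<comment> \<open>\<open>S^k\<close> has order at least \<open>k\<close>, so one bound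
    \<open>n\<close> serves all \<open>i \<le> n\<close> and two finite sums can be swapped.\<close>
  have "fps_nth (fps_compose (Abs_fps b) S) i = (\<Sum>k=0..n. b k * fps_nth (S ^ k) i)" if "i \<le> n" for i
    unfolding fps_compose_nth fps_nth_Abs_fps
    by (rule sum.mono_neutral_left) (use that startsby_zero_power_prefix[OF S0] in auto)
  then have "fps_nth (fps_compose (Abs_fps b) S * v) n = (\<Sum>i=0..n. (\<Sum>k=0..n. b k * fps_nth (S ^ k) i) * fps_nth v (n - i))"
    unfolding fps_mult_nth[of _ v] by (intro sum.cong refl) (simp only: atLeastAtMost_iff)
  also have "\<dots> = (\<Sum>k=0..n. b k * fps_nth (S ^ k * v) n)"
    unfolding fps_mult_nth sum_distrib_right sum_distrib_left by (subst sum.swap) (simp add: mult.assoc)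
  also have "\<dots> = (\<Sum>k=0..n. b k * of_nat ((n + (q - p) * k) choose (q * k)) * c ^ (n - p * k))"
  proof (intro sum.cong refl)
    fix k
    have inv: "inverse ((1 - fps_const c * fps_X) ^ (q * k + 1)) = v ^ (q * k + 1)"
      unfolding v_def by (rule fps_inverse_power)
    have "S ^ k * v = fps_X ^ (p * k) * inverse ((1 - fps_const c * fps_X) ^ (q * k + 1))"
      unfolding inv unfolding S_def power_mult_distrib power_add power_one_right
      by (simp only: power_mult mult.assoc)
    also have "inverse ((1 - fps_const c * fps_X) ^ (q * k + 1)) = Abs_fps (\<lambda>j. of_nat ((q * k + j) choose j) * c ^ j)"
      by (subst one_minus_const_fps_X_neg_power') auto
    finally have Sv: "fps_nth (S ^ k * v) n = (if n < p * k then 0 else of_nat ((q * k + (n - p * k)) choose (n - p * k)) * c ^ (n - p * k))"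
      by (simp add: fps_X_power_mult_nth)
    obtain e where q: "q = p + e" using assms(1) le_Suc_ex by blast
    show "b k * fps_nth (S ^ k * v) n = b k * of_nat ((n + (q - p) * k) choose (q * k)) * c ^ (n - p * k)"
    proof (cases "n < p * k")
      case True
      then show ?thesis unfolding Sv by (simp add: q binomial_eq_0 add_mult_distrib)
    next
      case False
      then have e1: "n + (q - p) * k = q * k + (n - p * k)" by (simp add: q add_mult_distrib)
      have e2: "(q * k + (n - p * k)) choose (n - p * k) = (q * k + (n - p * k)) choose (q * k)"
        using binomial_symmetric[of "n - p * k" "q * k + (n - p * k)"] by simp
      show ?thesis unfolding Sv e1 e2[symmetric] using False by (simp only: if_False mult.assoc)
    qed
  qed
  finally show "fps_nth (fps_compose (Abs_fps b) (fps_X ^ p * inverse (1 - fps_const c * fps_X) ^ q)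
      * inverse (1 - fps_const c * fps_X)) n = fps_nth (Abs_fps (comp_coeff p q c b)) n"
    by (simp only: S_def v_def comp_coeff_def atLeast0AtMost fps_nth_Abs_fps)
qed

lemma conv_radius_pos:
  fixes b :: "nat \<Rightarrow> complex"
  assumes "\<And>n. cmod (b n) \<le> K ^ n"
  shows "0 < fps_conv_radius (Abs_fps b)"
proof -
  have "cmod (b 1) \<le> K" using assms[of 1] by simp
  then have K: "0 \<le> K" by (rule order_trans[OF norm_ge_zero])
  define x where "x = 1 / (K + 1)"
  have x: "0 < x" "K * x < 1" using K by (auto simp: x_def divide_less_eq)
  have "summable (\<lambda>n. b n * of_real x ^ n)"
  proof (rule summable_comparison_test'[of "\<lambda>n. (K * x) ^ n" 0])
    show "summable (\<lambda>n. (K * x) ^ n)" using K x by (simp add: summable_geometric)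
    show "norm (b n * of_real x ^ n) \<le> (K * x) ^ n" for n
      using x mult_right_mono[OF assms[of n], of "x ^ n"]
      by (simp add: norm_mult norm_power power_mult_distrib)
  qed
  then have "ereal (norm (of_real x :: complex)) \<le> fps_conv_radius (Abs_fps b)"
    unfolding fps_conv_radius_def by (intro conv_radius_geI) simp
  moreover have "0 < ereal (norm (of_real x :: complex))"
    using x by simp
  ultimately show ?thesis by (rule less_le_trans[rotated])
qed

lemma log_fps_bound:
  assumes "\<And>n. cmod (b n) \<le> K ^ n"
  shows "cmod (b n / of_nat n) \<le> K ^ n"
proof (cases "n = 0")
  case False
  then have "cmod (b n / of_nat n) \<le> cmod (b n)"
    by (simp add: norm_divide divide_le_eq mult_le_cancel_left1)
  with assms[of n] show ?thesis by simp
qed simp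

text \<open>\<open>X d/dX\<close> cancels the denominators \<open>n\<close>. The product
  \<open>s * D\<close> is stated because solving for \<open>D\<close> would divide by 0 at the
  origin.\<close>

lemma has_field_derivative_log_fps:
  assumes b: "\<And>n. cmod (b n) \<le> K ^ n"
  shows "\<forall>\<^sub>F s in nhds 0. \<exists>D. (eval_fps (log_fps b) has_field_derivative D) (at s) \<and>
    s * D = eval_fps (Abs_fps b) s - b 0"
proof -
  let ?L = "log_fps b"
  have L: "0 < fps_conv_radius ?L"
    unfolding log_fps_def by (rule conv_radius_pos[OF log_fps_bound[OF b]])
  have "eval_fps ?L has_fps_expansion ?L"
    by (rule eval_fps_has_fps_expansion[OF L])
  have dL: "eval_fps (fps_deriv ?L) has_fps_expansion fps_deriv ?L"
    by (rule eval_fps_has_fps_expansion) (rule less_le_trans[OF L fps_conv_radius_deriv])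
  have "fps_X * fps_deriv ?L = Abs_fps b - fps_const (b 0)"
    by (rule fps_ext) (auto simp: log_fps_def)
  with has_fps_expansion_mult[OF has_fps_expansion_fps_X dL]
  have "(\<lambda>s. s * eval_fps (fps_deriv ?L) s) has_fps_expansion Abs_fps b - fps_const (b 0)"
    by simp
  then have 1: "\<forall>\<^sub>F s in nhds 0. eval_fps (Abs_fps b - fps_const (b 0)) s = s * eval_fps (fps_deriv ?L) s"
    by (simp add: has_fps_expansion_def)
  have "eval_fps (Abs_fps b) has_fps_expansion Abs_fps b"
    by (rule eval_fps_has_fps_expansion[OF conv_radius_pos[OF b]])
  then have "(\<lambda>s. eval_fps (Abs_fps b) s - b 0) has_fps_expansion Abs_fps b - fps_const (b 0)"
    by (intro fps_expansion_intros)
  then have 2: "\<forall>\<^sub>F s in nhds 0. eval_fps (Abs_fps b - fps_const (b 0)) s = eval_fps (Abs_fps b) s - b 0"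
    by (simp add: has_fps_expansion_def)
  have "\<forall>\<^sub>F s in nhds 0. s \<in> eball (0 :: complex) (fps_conv_radius ?L)"
    using L by (intro eventually_nhds_in_open) (auto simp: in_eball_iff zero_ereal_def)
  with 1 2 show ?thesis
  proof eventually_elim
    case (elim s)
    then have "(eval_fps ?L has_field_derivative eval_fps (fps_deriv ?L) s) (at s)"
      by (intro has_field_derivative_eval_fps) simp
    with elim show ?case by auto
  qed
qed

text \<open>The function \<open>U\<close> of the overview. Near \<open>t = 0\<close> the number
  \<open>1 - c t\<close> stays close to 1, away from the branch cut of \<open>Ln\<close>.\<close>

definition log_comp :: "nat \<Rightarrow> nat \<Rightarrow> complex \<Rightarrow> (nat \<Rightarrow> complex) \<Rightarrow> complex \<Rightarrow> complex" where
  "log_comp p q c b t = of_nat q * Ln (1 - c * t) - eval_fps (log_fps b) (t ^ p * inverse (1 - c * t) ^ q)"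

lemma log_comp_0: "0 < p \<Longrightarrow> log_comp p q c b 0 = 0"
  by (simp add: log_comp_def eval_fps_at_0 log_fps_def power_0_left)

text \<open>With \<open>g = 1/X\<close> one has
  \<open>t g'/g = (p + (q - p) c t) / (1 - c t)\<close>. The derivative of
  \<open>q Ln (1 - c t)\<close> combines with the -1 in \<open>s L'(s) = B(s) - 1\<close> to the
  constant \<open>p\<close>.\<close>

lemma has_field_derivative_log_comp:
  assumes b: "\<And>n. cmod (b n) \<le> K ^ n" and b0: "b 0 = 1" and pq: "0 < p" "p \<le> q"
  shows "\<forall>\<^sub>F t in nhds 0. \<exists>D. (log_comp p q c b has_field_derivative D) (at t) \<and>
    t * D = of_nat p - eval_fps (Abs_fps (comp_coeff p q c b)) t * (of_nat p + (of_nat q - of_nat p) * c * t)"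
proof -
  define g where "g = (\<lambda>t. t ^ p * inverse (1 - c * t) ^ q)"
  have g: "g has_fps_expansion fps_X ^ p * inverse (1 - fps_const c * fps_X) ^ q"
    unfolding g_def by (intro fps_expansion_intros) auto
  have g0: "g 0 = 0" using pq by (simp add: g_def)
  have "continuous (at 0) g"
    by (rule has_fps_expansion_imp_continuous[OF g])
  then have lim: "filterlim g (nhds 0) (nhds 0)"
    using tendsto_at_iff_tendsto_nhds[of g 0] g0 by (simp add: isCont_def)
  have H: "eval_fps (Abs_fps b) has_fps_expansion Abs_fps b"
    by (rule eval_fps_has_fps_expansion[OF conv_radius_pos[OF b]])
  have "(\<lambda>t. (eval_fps (Abs_fps b) \<circ> g) t * inverse (1 - c * t)) has_fps_expansion
      fps_compose (Abs_fps b) (fps_X ^ p * inverse (1 - fps_const c * fps_X) ^ q) * inverse (1 - fps_const c * fps_X)"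
    by (intro has_fps_expansion_mult has_fps_expansion_compose H g fps_expansion_intros)
       (use pq in \<open>auto simp: fps_mult_nth\<close>)
  then have "(\<lambda>t. eval_fps (Abs_fps b) (g t) * inverse (1 - c * t)) has_fps_expansion Abs_fps (comp_coeff p q c b)"
    unfolding comp_coeff_fps[OF pq(2,1)] o_def .
  then have ev1: "\<forall>\<^sub>F t in nhds 0. eval_fps (Abs_fps (comp_coeff p q c b)) t = eval_fps (Abs_fps b) (g t) * inverse (1 - c * t)"
    by (simp add: has_fps_expansion_def)
  have ev2: "\<forall>\<^sub>F t in nhds 0. \<exists>D. (eval_fps (log_fps b) has_field_derivative D) (at (g t)) \<and>
    g t * D = eval_fps (Abs_fps b) (g t) - 1"
    using filterlim_iff[THEN iffD1, OF lim, rule_format, OF has_field_derivative_log_fps[OF b]] b0 by simp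
  have "open {t. 0 < Re (1 - c * t)}"
    by (intro open_Collect_less continuous_intros)
  then have ev3: "\<forall>\<^sub>F t in nhds 0. 0 < Re (1 - c * t)"
    using eventually_nhds_in_open[of "{t. 0 < Re (1 - c * t)}" 0] by simp
  from ev1 ev2 ev3 show ?thesis
  proof eventually_elim
    case (elim t)
    then obtain D where D: "(eval_fps (log_fps b) has_field_derivative D) (at (g t))"
      "g t * D = eval_fps (Abs_fps b) (g t) - 1" by blast
    define v where "v = inverse (1 - c * t)"
    have nz: "1 - c * t \<noteq> 0" using elim(3) by (metis less_irrefl zero_complex.sel(1))
    obtain p' q' where pq': "p = Suc p'" "q = Suc q'"
      using pq gr0_implies_Suc[of p] gr0_implies_Suc[of q] by auto
    define gd where "gd = of_nat p * t ^ p' * v ^ q + t ^ p * (of_nat q * v ^ q' * (c * v\<^sup>2))"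
    have dv: "((\<lambda>t. inverse (1 - c * t)) has_field_derivative c * v\<^sup>2) (at t)"
      using nz by (auto intro!: derivative_eq_intros simp: v_def power2_eq_square)
    have dg: "(g has_field_derivative gd) (at t)"
      unfolding g_def gd_def pq'
      by (rule DERIV_cong[OF DERIV_mult[OF DERIV_power_Suc[OF DERIV_ident, of p'] DERIV_power_Suc[OF dv, of q']]])
         (simp add: v_def algebra_simps)
    have tgd: "t * gd = g t * (of_nat p + of_nat q * c * t * v)"
      unfolding gd_def g_def v_def[symmetric] pq' by (simp add: algebra_simps power2_eq_square)
    have "1 - c * t \<notin> \<real>\<^sub>\<le>\<^sub>0" using elim(3) by (auto simp: complex_nonpos_Reals_iff)
    then have dln: "((\<lambda>t. Ln (1 - c * t)) has_field_derivative - c * v) (at t)"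
      using nz by (auto intro!: derivative_eq_intros simp: v_def divide_inverse)
    have "(log_comp p q c b has_field_derivative of_nat q * (- c * v) - D * gd) (at t)"
    proof -
      have eq: "log_comp p q c b = (\<lambda>t. of_nat q * Ln (1 - c * t) - eval_fps (log_fps b) (g t))"
        by (simp add: log_comp_def fun_eq_iff g_def)
      show ?thesis
        unfolding eq by (rule DERIV_diff[OF DERIV_cmult[OF dln] DERIV_chain2[OF D(1) dg]])
    qed
    moreover have "t * (of_nat q * (- c * v) - D * gd)
      = of_nat p - eval_fps (Abs_fps (comp_coeff p q c b)) t * (of_nat p + (of_nat q - of_nat p) * c * t)"
    proof -
      have 1: "v * (1 - c * t) = 1" using nz by (simp add: v_def)
      have 2: "eval_fps (Abs_fps (comp_coeff p q c b)) t = eval_fps (Abs_fps b) (g t) * v"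
        using elim(1) by (simp add: v_def)
      have "t * (of_nat q * (- c * v) - D * gd) = - (of_nat q * c * v * t) - D * (t * gd)"
        by (simp add: algebra_simps)
      also have "\<dots> = - (of_nat q * c * v * t) - (g t * D) * (of_nat p + of_nat q * c * t * v)"
        unfolding tgd by (simp only: mult_ac)
      also have "\<dots> = of_nat p - eval_fps (Abs_fps b) (g t) * (of_nat p + of_nat q * c * t * v)"
        unfolding D(2) by (simp add: algebra_simps)
      \<comment> \<open>Inserting \<open>1 = v (1 - c t)\<close> puts both terms over the common
        denominator.\<close>
      also have "of_nat p + of_nat q * c * t * v = of_nat p * (v * (1 - c * t)) + of_nat q * c * t * v"
        unfolding 1 by simp
      also have "\<dots> = v * (of_nat p + (of_nat q - of_nat p) * c * t)"
        by (simp add: algebra_simps)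
      finally show ?thesis unfolding 2 by (simp only: mult.assoc)
    qed
    ultimately show ?case by blast
  qed
qed

text \<open>The hypothesis does not force \<open>D = 0\<close> at \<open>t = 0\<close>, but
  differentiability there still gives continuity, and one exceptional point does not affect
  constancy on a ball.\<close>

lemma constant_near_0:
  fixes E :: "complex \<Rightarrow> complex"
  assumes "\<forall>\<^sub>F t in nhds 0. \<exists>D. (E has_field_derivative D) (at t) \<and> t * D = 0"
  shows "\<forall>\<^sub>F t in nhds 0. E t = E 0"
proof -
  obtain r where r: "r > 0" "\<And>t. dist t 0 < r \<Longrightarrow> \<exists>D. (E has_field_derivative D) (at t) \<and> t * D = 0"
    using assms unfolding eventually_nhds_metric by blast
  have "continuous_on (ball 0 r) E"
  proof (intro continuous_at_imp_continuous_on ballI)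
    fix t assume "t \<in> ball (0 :: complex) r"
    then have "dist t 0 < r" by simp
    from r(2)[OF this] show "isCont E t" by (blast intro: DERIV_isCont)
  qed
  moreover have "\<forall>x\<in>ball 0 r - {0}. DERIV E x :> 0"
  proof
    fix t assume t: "t \<in> ball (0 :: complex) r - {0}"
    then have "dist t 0 < r" by simp
    from r(2)[OF this] t show "DERIV E t :> 0" by auto
  qed
  ultimately obtain c where c: "\<And>x. x \<in> ball 0 r \<Longrightarrow> E x = c"
    using DERIV_zero_connected_constant[of "ball 0 r" "{0}" E] by auto
  have "\<forall>\<^sub>F t in nhds 0. t \<in> ball (0 :: complex) r"
    using r(1) by (intro eventually_nhds_in_open) auto
  then show ?thesis
    by eventually_elim (use c r(1) in auto)
qed

section \<open>Mahler measures and constant terms\<close>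

text \<open>The constant term is encoded as a mean over the torus, the same integral as in the
  Mahler measure; \<open>has_bochner_integral\<close> carries integrability along with the
  value.\<close>

definition has_const_term :: "(complex^'n \<Rightarrow> complex) \<Rightarrow> complex \<Rightarrow> bool" where
  "has_const_term P c \<longleftrightarrow>
     has_bochner_integral lborel (\<lambda>\<theta>. indicator (cbox 0 1) \<theta> *\<^sub>R P (torus_point \<theta>)) c"

lemma norm_torus_point [simp]: "cmod (torus_point \<theta> $ i) = 1"
  by (simp add: torus_point_def norm_exp_eq_Re)

lemma torus_point_nonzero [simp]: "torus_point \<theta> $ i \<noteq> 0"
  using norm_torus_point[of \<theta> i] by (metis norm_zero zero_neq_one)

lemma continuous_torus_point [continuous_intros]: "continuous_on S (\<lambda>\<theta>. torus_point \<theta> $ i)"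
  unfolding torus_point_def by (auto intro!: continuous_intros)

lemma emeasure_unit_cube: "emeasure lborel (cbox 0 1 :: (real^'n) set) = 1"
proof -
  have "inner 1 b = (1 :: real)" if "b \<in> Basis" for b :: "real^'n"
    using that by (auto simp: Basis_vec_def inner_axis)
  then show ?thesis
    by (subst emeasure_lborel_cbox) (auto intro!: prod.neutral)
qed

lemma has_const_term_cong:
  assumes "has_const_term P c" "\<And>v. (\<And>i. cmod (v $ i) = 1) \<Longrightarrow> P v = Q v"
  shows "has_const_term Q c"
  using assms by (simp add: has_const_term_def)

lemma has_const_term_sum:
  assumes "\<And>i. i \<in> I \<Longrightarrow> has_const_term (P i) (c i)"
  shows "has_const_term (\<lambda>v. \<Sum>i\<in>I. P i v) (\<Sum>i\<in>I. c i)"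
  using has_bochner_integral_sum[OF assms[unfolded has_const_term_def]]
  by (simp add: has_const_term_def scaleR_sum_right)

lemma has_const_term_cmult:
  assumes "has_const_term P c"
  shows "has_const_term (\<lambda>v. a * P v) (a * c)"
proof -
  have "has_bochner_integral lborel (\<lambda>\<theta>. a * indicator (cbox 0 1) \<theta> *\<^sub>R P (torus_point \<theta>)) (a * c)"
    by (rule has_bochner_integral_mult_right) (rule assms[unfolded has_const_term_def])
  then show ?thesis by (simp add: has_const_term_def)
qed

text \<open>Orthogonality without iterated integrals: if \<open>e k\<close> is nonzero, a suitable
  translation of the \<open>k\<close>-th coordinate changes the sign of the monomial but not its
  integral over the cube.\<close>

lemma has_const_term_monom:
  fixes e :: "'n::finite \<Rightarrow> int"
  shows "has_const_term (\<lambda>v. \<Prod>i\<in>UNIV. v $ i powi e i) (of_bool (\<forall>i. e i = 0))"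
proof (cases "\<forall>i. e i = 0")
  case True
  have "has_bochner_integral lborel (indicator (cbox 0 1 :: (real^'n) set)) (measure lborel (cbox 0 1 :: (real^'n) set))"
    by (rule has_bochner_integral_real_indicator) (simp_all add: emeasure_unit_cube)
  then have "has_bochner_integral lborel (\<lambda>\<theta>. indicator (cbox 0 1 :: (real^'n) set) \<theta> *\<^sub>R (1 :: complex))
      (measure lborel (cbox 0 1 :: (real^'n) set) *\<^sub>R 1)"
    by (intro has_bochner_integral_scaleR_left)
  with True show ?thesis by (simp add: has_const_term_def measure_def emeasure_unit_cube)
next
  case False
  then obtain k where k: "e k \<noteq> 0" by auto
  define f where "f = (\<lambda>\<theta> :: real^'n. \<Prod>i\<in>UNIV. torus_point \<theta> $ i powi e i)"
  have f_eq: "f \<theta> = (\<Prod>i\<in>UNIV. exp (2 * of_real pi * \<i> * of_real (\<theta> $ i) * of_int (e i)))" for \<theta>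
    unfolding f_def torus_point_def by (simp add: exp_power_int mult_ac)
  have cont: "continuous_on UNIV f"
    unfolding f_eq by (intro continuous_intros)
  then have [measurable]: "f \<in> borel_measurable borel"
    by (rule borel_measurable_continuous_onI)
  have int: "integrable lborel (\<lambda>\<theta>. indicator (cbox 0 1) \<theta> *\<^sub>R f \<theta>)"
    by (rule borel_integrable_compact) (auto intro: continuous_on_subset[OF cont])
  have shift: "f (\<theta> + axis k c) = exp (2 * of_real pi * \<i> * of_real c * of_int (e k)) * f \<theta>" for \<theta> c
  proof -
    have "f (\<theta> + axis k c) = (\<Prod>i\<in>UNIV. exp (2 * of_real pi * \<i> * of_real (\<theta> $ i) * of_int (e i))
        * (if i = k then exp (2 * of_real pi * \<i> * of_real c * of_int (e k)) else 1))"
      unfolding f_eq by (intro prod.cong refl) (simp add: axis_def exp_add[symmetric] algebra_simps)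
    then show ?thesis by (simp add: prod.distrib f_eq mult.commute)
  qed
  have per: "f (\<theta> + axis k 1) = f \<theta>" for \<theta>
    unfolding shift using exp_integer_2pi[of "of_int (e k)"] by (simp add: mult_ac)
  \<comment> \<open>Chosen so that \<open>c * e k\<close> is 1/2 or -1/2 and the phase is -1; the
    absolute value keeps \<open>c\<close> in the range allowed by the translation lemma.\<close>
  define c where "c = 1 / (2 * \<bar>of_int (e k)\<bar> :: real)"
  have c: "0 \<le> c" "c \<le> 1"
    using k by (auto simp: c_def field_simps)
  have "exp (2 * of_real pi * \<i> * of_real c * of_int (e k)) = (-1 :: complex)"
  proof -
    have E: "2 * of_real pi * \<i> * of_real c * of_int (e k) = of_real pi * \<i> * (of_int (sgn (e k)) :: complex)"
      using k by (cases "e k > 0") (auto simp: c_def sgn_if abs_if field_simps)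
    show ?thesis unfolding E using k
      by (cases "e k > 0") (auto simp: sgn_if exp_minus mult.commute[of _ \<i>])
  qed
  then have neg: "f (\<theta> + axis k c) = - f \<theta>" for \<theta>
    unfolding shift by simp
  have Re: "(LINT \<theta>:cbox 0 1|lborel. Re (f \<theta>)) = 0"
    using set_integral_cube_periodic_shift[of "\<lambda>\<theta>. Re (f \<theta>)" k c] c
    by (simp add: per neg set_lebesgue_integral_def)
  have Im: "(LINT \<theta>:cbox 0 1|lborel. Im (f \<theta>)) = 0"
    using set_integral_cube_periodic_shift[of "\<lambda>\<theta>. Im (f \<theta>)" k c] c
    by (simp add: per neg set_lebesgue_integral_def)
  have "(\<integral>\<theta>. indicator (cbox 0 1) \<theta> *\<^sub>R f \<theta> \<partial>lborel) = 0"
  proof (rule complex_eqI)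
    show "Re (\<integral>\<theta>. indicator (cbox 0 1) \<theta> *\<^sub>R f \<theta> \<partial>lborel) = Re 0"
      using Re int by (simp add: set_lebesgue_integral_def integral_Re[symmetric] del: integral_Re)
    show "Im (\<integral>\<theta>. indicator (cbox 0 1) \<theta> *\<^sub>R f \<theta> \<partial>lborel) = Im 0"
      using Im int by (simp add: set_lebesgue_integral_def integral_Im[symmetric] del: integral_Im)
  qed
  with int False show ?thesis
    unfolding has_const_term_def f_def by (simp add: has_bochner_integral_iff)
qed

lemma has_const_term_laurent3:
  fixes a :: "'i \<Rightarrow> complex" and e1 e2 e3 :: "'i \<Rightarrow> int"
  assumes "finite I"
  shows "has_const_term (\<lambda>v :: complex^3. \<Sum>i\<in>I. a i * (v $ 1 powi e1 i * v $ 2 powi e2 i * v $ 3 powi e3 i))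
     (\<Sum>i | i \<in> I \<and> e1 i = 0 \<and> e2 i = 0 \<and> e3 i = 0. a i)"
proof -
  have "has_const_term (\<lambda>v :: complex^3. v $ 1 powi x * v $ 2 powi y * v $ 3 powi z) (of_bool (x = 0 \<and> y = 0 \<and> z = 0))" for x y z
    using has_const_term_monom[of "\<lambda>i :: 3. if i = 1 then x else if i = 2 then y else z"]
    unfolding UNIV_3 forall_3 by (simp add: mult.assoc)
  from has_const_term_sum[OF has_const_term_cmult[OF this]]
  have "has_const_term (\<lambda>v :: complex^3. \<Sum>i\<in>I. a i * (v $ 1 powi e1 i * v $ 2 powi e2 i * v $ 3 powi e3 i))
     (\<Sum>i\<in>I. a i * of_bool (e1 i = 0 \<and> e2 i = 0 \<and> e3 i = 0))" .
  also have "(\<Sum>i\<in>I. a i * of_bool (e1 i = 0 \<and> e2 i = 0 \<and> e3 i = 0)) = (\<Sum>i | i \<in> I \<and> e1 i = 0 \<and> e2 i = 0 \<and> e3 i = 0. a i)"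
    using assms by (intro sum.mono_neutral_cong_right) auto
  finally show ?thesis .
qed

lemma has_const_term_prod3:
  fixes a b c :: "nat \<Rightarrow> complex" and e f g :: "nat \<Rightarrow> int"
  assumes "finite A" "finite B" "finite C"
  shows "has_const_term (\<lambda>v :: complex^3. (\<Sum>i\<in>A. a i * v $ 1 powi e i) * (\<Sum>j\<in>B. b j * v $ 2 powi f j)
       * (\<Sum>k\<in>C. c k * v $ 3 powi g k))
     ((\<Sum>i | i \<in> A \<and> e i = 0. a i) * (\<Sum>j | j \<in> B \<and> f j = 0. b j) * (\<Sum>k | k \<in> C \<and> g k = 0. c k))"
proof -
  have prod: "(\<Sum>i\<in>A. p i) * (\<Sum>j\<in>B. q j) * (\<Sum>k\<in>C. r k) = (\<Sum>(i, j, k)\<in>A \<times> B \<times> C. p i * q j * r k)"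
    for A B C and p q r :: "nat \<Rightarrow> complex"
  proof -
    have A: "(\<Sum>i\<in>A. p i) * (\<Sum>j\<in>B. q j) * s = (\<Sum>i\<in>A. \<Sum>j\<in>B. p i * q j * s)" for s
      by (subst sum_product) (simp only: sum_distrib_right)
    have "(\<Sum>i\<in>A. p i) * (\<Sum>j\<in>B. q j) * (\<Sum>k\<in>C. r k) = (\<Sum>i\<in>A. \<Sum>j\<in>B. \<Sum>k\<in>C. p i * q j * r k)"
      unfolding A by (simp only: sum_distrib_left)
    then show ?thesis by (simp add: sum.cartesian_product)
  qed
  have "has_const_term (\<lambda>v :: complex^3. \<Sum>t\<in>A \<times> B \<times> C. (case t of (i, j, k) \<Rightarrow> a i * b j * c k)
       * (v $ 1 powi (case t of (i, j, k) \<Rightarrow> e i) * v $ 2 powi (case t of (i, j, k) \<Rightarrow> f j)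
         * v $ 3 powi (case t of (i, j, k) \<Rightarrow> g k)))
     (\<Sum>t | t \<in> A \<times> B \<times> C \<and> (case t of (i, j, k) \<Rightarrow> e i) = 0 \<and> (case t of (i, j, k) \<Rightarrow> f j) = 0
         \<and> (case t of (i, j, k) \<Rightarrow> g k) = 0. case t of (i, j, k) \<Rightarrow> a i * b j * c k)"
    by (rule has_const_term_laurent3) (use assms in auto)
  moreover have "{t. t \<in> A \<times> B \<times> C \<and> (case t of (i, j, k) \<Rightarrow> e i) = 0 \<and> (case t of (i, j, k) \<Rightarrow> f j) = 0
         \<and> (case t of (i, j, k) \<Rightarrow> g k) = 0} = {i \<in> A. e i = 0} \<times> {j \<in> B. f j = 0} \<times> {k \<in> C. g k = 0}"
    by auto
  moreover have "(\<Sum>t\<in>A \<times> B \<times> C. (case t of (i, j, k) \<Rightarrow> a i * b j * c k)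
       * (v $ 1 powi (case t of (i, j, k) \<Rightarrow> e i) * v $ 2 powi (case t of (i, j, k) \<Rightarrow> f j)
         * v $ 3 powi (case t of (i, j, k) \<Rightarrow> g k)))
      = (\<Sum>i\<in>A. a i * v $ 1 powi e i) * (\<Sum>j\<in>B. b j * v $ 2 powi f j) * (\<Sum>k\<in>C. c k * v $ 3 powi g k)"
    for v :: "complex^3"
    unfolding prod by (intro sum.cong refl) (auto simp: mult_ac)
  ultimately show ?thesis
    by (simp add: prod)
qed

text \<open>Expanding the logarithm in powers of \<open>Q / u\<close> and integrating term by term.\<close>

lemma mahler_measure_series:
  fixes Q :: "complex^'n \<Rightarrow> complex"
  assumes cont: "continuous_on UNIV (\<lambda>\<theta>. Q (torus_point \<theta>))"
    and bound: "\<And>v. (\<And>i. cmod (v $ i) = 1) \<Longrightarrow> cmod (Q v) \<le> M" and u: "M < cmod u"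
    and c: "\<And>n. has_const_term (\<lambda>v. Q v ^ n) (c n)"
  shows "(\<lambda>n. Re (c n / (of_nat n * u ^ n))) sums (ln (cmod u) - mahler_measure (\<lambda>v. u - Q v))"
proof -
  define q where "q = (\<lambda>\<theta>. Q (torus_point \<theta>))"
  have q: "cmod (q \<theta>) \<le> M" for \<theta>
    unfolding q_def by (rule bound) simp
  from q[of 0] have M: "0 \<le> M" using norm_ge_zero order_trans by blast
  with u have u0: "u \<noteq> 0" by auto
  define r where "r = M / cmod u"
  have r: "0 \<le> r" "r < 1"
    using M u u0 by (auto simp: r_def divide_less_eq)
  have qu: "cmod (q \<theta> / u) \<le> r" for \<theta>
    unfolding r_def norm_divide by (intro divide_right_mono q) auto
  define f where "f = (\<lambda>n \<theta>. indicator (cbox 0 1) \<theta> *\<^sub>R Re (q \<theta> ^ n / (of_nat n * u ^ n)))"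
  have hasint: "has_bochner_integral lborel (f n) (Re (c n / (of_nat n * u ^ n)))" for n
  proof -
    have "has_const_term (\<lambda>v. (1 / (of_nat n * u ^ n)) * Q v ^ n) ((1 / (of_nat n * u ^ n)) * c n)"
      by (rule has_const_term_cmult[OF c])
    from has_bochner_integral_Re[OF this[unfolded has_const_term_def]]
    show ?thesis by (simp add: f_def q_def)
  qed
  \<comment> \<open>A geometric majorant independent of \<open>\<theta>\<close>; the term
    \<open>n = 0\<close> is 0 by division by zero.\<close>
  have fb: "norm (f n \<theta>) \<le> indicator (cbox 0 1) \<theta> * r ^ n" for n \<theta>
  proof (cases "n = 0 \<or> \<theta> \<notin> cbox 0 1")
    case False
    have "\<bar>Re (q \<theta> ^ n / (of_nat n * u ^ n))\<bar> \<le> cmod (q \<theta> ^ n / (of_nat n * u ^ n))"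
      by (rule abs_Re_le_cmod)
    also have "\<dots> = cmod (q \<theta> / u) ^ n / real n"
      by (simp add: norm_divide norm_mult norm_power power_divide)
    also have "\<dots> \<le> cmod (q \<theta> / u) ^ n"
      using False by (simp add: divide_le_eq mult_le_cancel_left1)
    also have "\<dots> \<le> r ^ n"
      by (intro power_mono qu) auto
    finally show ?thesis using False by (simp add: f_def)
  qed (use r in \<open>auto simp: f_def\<close>)
  have log_sums: "(\<lambda>n. f n \<theta>) sums (indicator (cbox 0 1) \<theta> *\<^sub>R (ln (cmod u) - ln (cmod (u - q \<theta>))))" for \<theta>
  proof -
    have lt: "cmod (- (q \<theta> / u)) < 1" using qu[of \<theta>] r by simp
    then have ne: "1 - q \<theta> / u \<noteq> 0" by auto
    have "(\<lambda>n. Re (- ((- (- (q \<theta> / u))) ^ n) / of_nat n)) sums Re (Ln (1 + - (q \<theta> / u)))"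
      by (rule sums_Re[OF Ln_series'[OF lt]])
    then have "(\<lambda>n. - Re (q \<theta> ^ n / (of_nat n * u ^ n))) sums ln (cmod (1 - q \<theta> / u))"
      using ne by (simp add: power_divide mult.commute)
    then have "(\<lambda>n. Re (q \<theta> ^ n / (of_nat n * u ^ n))) sums (- ln (cmod (1 - q \<theta> / u)))"
      using sums_minus by fastforce
    moreover have "u - q \<theta> = u * (1 - q \<theta> / u)" using u0 by (simp add: field_simps)
    then have "ln (cmod (u - q \<theta>)) = ln (cmod u) + ln (cmod (1 - q \<theta> / u))"
      using u0 ne by (simp add: norm_mult ln_mult)
    ultimately show ?thesis
      unfolding f_def by (intro sums_scaleR_right) simp
  qed
  have ind: "has_bochner_integral lborel (indicator (cbox 0 1 :: (real^'n) set) :: _ \<Rightarrow> real) 1"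
    using has_bochner_integral_real_indicator[of "cbox 0 1 :: (real^'n) set" lborel]
    by (simp add: emeasure_unit_cube measure_def)
  have sum_norm: "summable (\<lambda>n. \<integral>\<theta>. norm (f n \<theta>) \<partial>lborel)"
  proof (rule summable_comparison_test'[of "\<lambda>n. r ^ n" 0])
    show "summable (\<lambda>n. r ^ n)" using r by (simp add: summable_geometric)
    fix n
    have "(\<integral>\<theta>. norm (f n \<theta>) \<partial>lborel) \<le> (\<integral>\<theta>. indicator (cbox 0 1 :: (real^'n) set) \<theta> * r ^ n \<partial>lborel)"
      by (rule integral_mono)
        (use hasint[of n] ind fb in \<open>auto simp: has_bochner_integral_iff\<close>)
    also have "\<dots> = r ^ n"
      using ind by (simp add: has_bochner_integral_iff)
    finally show "norm (\<integral>\<theta>. norm (f n \<theta>) \<partial>lborel) \<le> r ^ n"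
      by simp
  qed
  have AE: "AE \<theta> in lborel. summable (\<lambda>n. norm (f n \<theta>))"
  proof (rule AE_I2)
    fix \<theta> :: "real^'n"
    show "summable (\<lambda>n. norm (f n \<theta>))"
    proof (rule summable_comparison_test'[of "\<lambda>n. r ^ n" 0])
      show "summable (\<lambda>n. r ^ n)" using r by (simp add: summable_geometric)
      show "norm (norm (f n \<theta>)) \<le> r ^ n" for n
        using fb[of n \<theta>] r zero_le_power[of r n] by (cases "\<theta> \<in> cbox 0 1") auto
    qed
  qed
  note int = hasint[THEN has_bochner_integral_integral_eq] hasint[THEN integrable.intros]
  have sums: "(\<lambda>n. Re (c n / (of_nat n * u ^ n))) sums (\<integral>\<theta>. (\<Sum>n. f n \<theta>) \<partial>lborel)"
    and integ: "integrable lborel (\<lambda>\<theta>. \<Sum>n. f n \<theta>)"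
    using sums_integral[OF int(2) AE sum_norm] integrable_suminf[OF int(2) AE sum_norm]
    unfolding int(1) by auto
  have eq: "(\<Sum>n. f n \<theta>) = indicator (cbox 0 1) \<theta> * ln (cmod u) - indicator (cbox 0 1) \<theta> *\<^sub>R ln (cmod (u - q \<theta>))" for \<theta>
    using sums_unique[OF log_sums[of \<theta>]] by (simp add: algebra_simps)
  have "has_bochner_integral lborel (\<lambda>\<theta>. indicator (cbox 0 1 :: (real^'n) set) \<theta> * ln (cmod u)) (1 * ln (cmod u))"
    by (intro has_bochner_integral_mult_left impI ind)
  from has_bochner_integral_diff[OF this has_bochner_integral_integrable[OF integ]]
  have "has_bochner_integral lborel (\<lambda>\<theta>. indicator (cbox 0 1) \<theta> *\<^sub>R ln (cmod (u - q \<theta>)))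
      (ln (cmod u) - (\<integral>\<theta>. (\<Sum>n. f n \<theta>) \<partial>lborel))"
    unfolding eq by simp
  then have "mahler_measure (\<lambda>v. u - Q v) = ln (cmod u) - (\<integral>\<theta>. (\<Sum>n. f n \<theta>) \<partial>lborel)"
    unfolding mahler_measure_def set_lebesgue_integral_def q_def
    by (rule has_bochner_integral_integral_eq)
  with sums show ?thesis by simp
qed

text \<open>A bound for \<open>Q\<close> on the torus yields the geometric growth bound needed for
  the power series, without estimating factorials.\<close>

lemma has_const_term_power_bound:
  fixes Q :: "complex^'n \<Rightarrow> complex"
  assumes bound: "\<And>v. (\<And>i. cmod (v $ i) = 1) \<Longrightarrow> cmod (Q v) \<le> M"
    and c: "has_const_term (\<lambda>v. Q v ^ n) c"
  shows "cmod c \<le> M ^ n"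
proof -
  have ind: "has_bochner_integral lborel (indicator (cbox 0 1 :: (real^'n) set) :: _ \<Rightarrow> real) 1"
    using has_bochner_integral_real_indicator[of "cbox 0 1 :: (real^'n) set" lborel]
    by (simp add: emeasure_unit_cube measure_def)
  have "c = (\<integral>\<theta>. indicator (cbox 0 1) \<theta> *\<^sub>R Q (torus_point \<theta>) ^ n \<partial>lborel)"
    using c unfolding has_const_term_def by (simp add: has_bochner_integral_iff)
  also have "cmod \<dots> \<le> (\<integral>\<theta>. norm (indicator (cbox 0 1) \<theta> *\<^sub>R Q (torus_point \<theta>) ^ n) \<partial>lborel)"
    by (rule integral_norm_bound)
  also have "\<dots> \<le> (\<integral>\<theta>. indicator (cbox 0 1 :: (real^'n) set) \<theta> * M ^ n \<partial>lborel)"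
  proof (rule integral_mono)
    show "integrable lborel (\<lambda>\<theta>. norm (indicator (cbox 0 1) \<theta> *\<^sub>R Q (torus_point \<theta>) ^ n))"
      using c unfolding has_const_term_def by (intro integrable_norm) (simp add: has_bochner_integral_iff)
    show "integrable lborel (\<lambda>\<theta>. indicator (cbox 0 1 :: (real^'n) set) \<theta> * M ^ n)"
      using ind by (simp add: has_bochner_integral_iff)
    show "norm (indicator (cbox 0 1) \<theta> *\<^sub>R Q (torus_point \<theta>) ^ n) \<le> indicator (cbox 0 1) \<theta> * M ^ n" for \<theta>
      using power_mono[OF bound norm_ge_zero, of "torus_point \<theta>" n]
      by (cases "\<theta> \<in> cbox 0 1") (simp_all add: norm_power)
  qed
  also have "\<dots> = M ^ n"
    using ind by (simp add: has_bochner_integral_iff)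
  finally show ?thesis .
qed

section \<open>Constant terms of the four Laurent polynomials\<close>

lemma power_plus_inverse:
  fixes x :: complex
  assumes "x \<noteq> 0"
  shows "(x + inverse x) ^ n = (\<Sum>k\<le>n. of_nat (n choose k) * x powi (2 * int k - int n))"
proof -
  have "x ^ k * inverse x ^ (n - k) = x powi (2 * int k - int n)" if "k \<le> n" for k
  proof -
    have eq: "2 * int k - int n = int k + - int (n - k)" using that by simp
    show ?thesis unfolding eq using assms
      by (subst power_int_add) (simp_all add: power_int_minus power_inverse del: of_nat_diff)
  qed
  then show ?thesis
    unfolding binomial_ring by (intro sum.cong refl) (simp add: mult.assoc)
qed

text \<open>The constant term of \<open>(x + 1/x)^n\<close>, left in the form in which
  \<open>has_const_term_prod3\<close> delivers it.\<close>

definition even_binomial :: "nat \<Rightarrow> complex" where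
  "even_binomial n = (\<Sum>k | k \<in> {..n} \<and> 2 * int k - int n = 0. of_nat (n choose k))"

lemma even_binomial_even: "even_binomial (2 * n) = of_nat ((2 * n) choose n)"
proof -
  have "{k. k \<in> {..2 * n} \<and> 2 * int k - int (2 * n) = 0} = {n}" by auto
  then show ?thesis unfolding even_binomial_def by simp
qed

lemma even_binomial_odd: "odd n \<Longrightarrow> even_binomial n = 0"
proof -
  assume "odd n"
  then have "{k. k \<in> {..n} \<and> 2 * int k - int n = 0} = {}" by auto presburger
  then show ?thesis by (simp only: even_binomial_def sum.empty)
qed

lemma norm_plus_inverse_le:
  assumes "cmod x = 1"
  shows "cmod (x + inverse x) \<le> 2"
  using norm_triangle_ineq[of x "inverse x"] assms by (simp add: norm_inverse)

text \<open>The three variables separate, with factors \<open>2n choose n\<close> twice and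
  \<open>3n choose 2n\<close>, the latter from \<open>(1 + z)^(3n) z^(-2n)\<close>.\<close>

lemma has_const_term_cubic:
  "has_const_term (\<lambda>v :: complex^3. ((v $ 1 + inverse (v $ 1))\<^sup>2 * (v $ 2 + inverse (v $ 2))\<^sup>2
      * (1 + v $ 3) ^ 3 * v $ 3 powi (-2)) ^ n) (cubic_coeff n)"
proof (rule has_const_term_cong)
  have *: "{k. k \<in> {..3 * n} \<and> int k - 2 * int n = 0} = {2 * n}" by auto
  have "of_nat ((2 * n) choose n) * of_nat ((2 * n) choose n) * of_nat ((3 * n) choose (2 * n)) = cubic_coeff n"
    by (simp add: cubic_coeff_def binomial_fact eval_nat_numeral)
  with has_const_term_prod3[of "{..2 * n}" "{..2 * n}" "{..3 * n}"
      "\<lambda>k. of_nat ((2 * n) choose k)" "\<lambda>k. 2 * int k - int (2 * n)"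
      "\<lambda>k. of_nat ((2 * n) choose k)" "\<lambda>k. 2 * int k - int (2 * n)"
      "\<lambda>k. of_nat ((3 * n) choose k)" "\<lambda>k. int k - 2 * int n"]
  show "has_const_term (\<lambda>v :: complex^3. (\<Sum>k\<le>2 * n. of_nat ((2 * n) choose k) * v $ 1 powi (2 * int k - int (2 * n)))
     * (\<Sum>k\<le>2 * n. of_nat ((2 * n) choose k) * v $ 2 powi (2 * int k - int (2 * n)))
     * (\<Sum>k\<le>3 * n. of_nat ((3 * n) choose k) * v $ 3 powi (int k - 2 * int n))) (cubic_coeff n)"
    unfolding * even_binomial_def[symmetric] even_binomial_even by simp
next
  fix v :: "complex^3" assume v: "\<And>i. cmod (v $ i) = 1"
  have nz: "v $ i \<noteq> 0" for i using v[of i] by auto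
  have "((1 + v $ 3) ^ 3 * v $ 3 powi (-2)) ^ n = (v $ 3 + 1) ^ (3 * n) * v $ 3 powi (- 2 * int n)"
    using power_int_mult[of "v $ 3" "-2" "int n"] by (simp add: power_mult_distrib power_mult add.commute)
  also have "\<dots> = (\<Sum>k\<le>3 * n. of_nat ((3 * n) choose k) * v $ 3 powi (int k - 2 * int n))"
    unfolding binomial_ring sum_distrib_right
    by (intro sum.cong refl) (simp add: power_int_diff power_int_minus nz field_simps)
  finally show "(\<Sum>k\<le>2 * n. of_nat ((2 * n) choose k) * v $ 1 powi (2 * int k - int (2 * n)))
     * (\<Sum>k\<le>2 * n. of_nat ((2 * n) choose k) * v $ 2 powi (2 * int k - int (2 * n)))
     * (\<Sum>k\<le>3 * n. of_nat ((3 * n) choose k) * v $ 3 powi (int k - 2 * int n))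
     = ((v $ 1 + inverse (v $ 1))\<^sup>2 * (v $ 2 + inverse (v $ 2))\<^sup>2 * (1 + v $ 3) ^ 3 * v $ 3 powi (-2)) ^ n"
    unfolding power_plus_inverse[OF nz, symmetric]
    by (simp add: power_mult_distrib power_mult mult.assoc)
qed

lemma sum_even_binomial:
  "(\<Sum>k\<le>2 * m. even_binomial k * f k) = (\<Sum>k\<le>m. of_nat ((2 * k) choose k) * f (2 * k))"
proof -
  have "(\<Sum>k\<le>2 * m. even_binomial k * f k) = (\<Sum>k\<in>(\<lambda>k. 2 * k) ` {..m}. even_binomial k * f k)"
  proof (rule sum.mono_neutral_right)
    show "\<forall>k\<in>{..2 * m} - (\<lambda>k. 2 * k) ` {..m}. even_binomial k * f k = 0"
      by (auto simp: even_binomial_odd elim!: evenE intro!: even_binomial_odd)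
  qed auto
  also have "\<dots> = (\<Sum>k\<le>m. of_nat ((2 * k) choose k) * f (2 * k))"
    by (subst sum.reindex) (auto simp: inj_on_def even_binomial_even)
  finally show ?thesis .
qed

lemma binomial_add_fact: "of_nat ((i + j) choose i) = (fact (i + j) / (fact i * fact j) :: complex)"
  by (simp add: binomial_fact)

lemma choose_square_sum_complex: "(\<Sum>k\<le>n. (of_nat (n choose k))\<^sup>2) = (of_nat ((2 * n) choose n) :: complex)"
  unfolding choose_square_sum[symmetric] by simp

text \<open>Only even exponents \<open>2a, 2b, 2c\<close> with \<open>a + b + c = m\<close>
  contribute, and \<open>(2m)! / (a! b! c!)^2\<close> is \<open>2m choose m\<close> times the square
  of \<open>m! / (a! b! c!)\<close>. Summing over \<open>b\<close> by Vandermonde leaves the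
  honeycomb sum with \<open>a\<close> replaced by \<open>m - a\<close>.\<close>

lemma has_const_term_lattice:
  "has_const_term (\<lambda>v :: complex^3. (v $ 1 + inverse (v $ 1) + (v $ 2 + inverse (v $ 2)) + (v $ 3 + inverse (v $ 3))) ^ n)
     (if even n then lattice_coeff (n div 2) else 0)"
proof -
  define L where "L = (\<Sum>i\<le>n. \<Sum>j\<le>n-i. (of_nat (n choose i) * of_nat ((n - i) choose j))
     * (even_binomial i * even_binomial j * even_binomial (n - i - j)))"
  have "has_const_term (\<lambda>v :: complex^3. \<Sum>i\<le>n. \<Sum>j\<le>n-i. (of_nat (n choose i) * of_nat ((n - i) choose j))
     * ((\<Sum>k\<le>i. of_nat (i choose k) * v $ 1 powi (2 * int k - int i))
     * (\<Sum>k\<le>j. of_nat (j choose k) * v $ 2 powi (2 * int k - int j))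
     * (\<Sum>k\<le>n-i-j. of_nat ((n-i-j) choose k) * v $ 3 powi (2 * int k - int (n - i - j))))) L"
    unfolding L_def even_binomial_def
    by (intro has_const_term_sum has_const_term_cmult has_const_term_prod3) auto
  then have "has_const_term (\<lambda>v :: complex^3. (v $ 1 + inverse (v $ 1) + (v $ 2 + inverse (v $ 2)) + (v $ 3 + inverse (v $ 3))) ^ n) L"
  proof (rule has_const_term_cong)
    fix v :: "complex^3" assume v: "\<And>i. cmod (v $ i) = 1"
    have nz: "v $ i \<noteq> 0" for i using v[of i] by auto
    have "(x + y + z) ^ n = (\<Sum>i\<le>n. \<Sum>j\<le>n-i. (of_nat (n choose i) * of_nat ((n - i) choose j)) * (x ^ i * y ^ j * z ^ (n - i - j)))"
      for x y z :: complex
      unfolding add.assoc binomial_ring sum_distrib_left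
      by (simp add: mult_ac)
    then show "(\<Sum>i\<le>n. \<Sum>j\<le>n-i. (of_nat (n choose i) * of_nat ((n - i) choose j))
     * ((\<Sum>k\<le>i. of_nat (i choose k) * v $ 1 powi (2 * int k - int i))
     * (\<Sum>k\<le>j. of_nat (j choose k) * v $ 2 powi (2 * int k - int j))
     * (\<Sum>k\<le>n-i-j. of_nat ((n-i-j) choose k) * v $ 3 powi (2 * int k - int (n - i - j)))))
     = (v $ 1 + inverse (v $ 1) + (v $ 2 + inverse (v $ 2)) + (v $ 3 + inverse (v $ 3))) ^ n"
      unfolding power_plus_inverse[OF nz, symmetric] by simp
  qed
  also have "L = (if even n then lattice_coeff (n div 2) else 0)"
  proof (cases "even n")
    case False
    have "even_binomial i * even_binomial j * even_binomial (n - i - j) = 0" if "i \<le> n" "j \<le> n - i" for i j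
    proof -
      have "odd i \<or> odd j \<or> odd (n - i - j)" using that False
        by (metis add.assoc le_add_diff_inverse odd_add)
      then show ?thesis by (elim disjE) (simp_all add: even_binomial_odd)
    qed
    then have "L = 0" unfolding L_def by (intro sum.neutral ballI) auto
    with False show ?thesis by simp
  next
    case True
    then obtain m where n: "n = 2 * m" by auto
    have "L = (\<Sum>i\<le>2*m. even_binomial i * (of_nat ((2 * m) choose i)
       * (\<Sum>j\<le>2*m-i. even_binomial j * (of_nat ((2 * m - i) choose j) * even_binomial (2 * m - i - j)))))"
      unfolding L_def n by (simp add: sum_distrib_left mult_ac)
    also have "\<dots> = (\<Sum>a\<le>m. of_nat ((2 * a) choose a) * (of_nat ((2 * m) choose (2 * a))
       * (\<Sum>j\<le>2*(m-a). even_binomial j * (of_nat ((2 * (m - a)) choose j) * even_binomial (2 * (m - a) - j)))))"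
      by (subst sum_even_binomial) (simp only: diff_mult_distrib2)
    also have "\<dots> = (\<Sum>a\<le>m. of_nat ((2 * a) choose a) * (of_nat ((2 * m) choose (2 * a))
       * (\<Sum>b\<le>m-a. of_nat ((2 * b) choose b) * (of_nat ((2 * (m - a)) choose (2 * b)) * of_nat ((2 * (m - a - b)) choose (m - a - b))))))"
      by (simp only: sum_even_binomial diff_mult_distrib2[symmetric] even_binomial_even)
    also have "\<dots> = (\<Sum>a\<le>m. of_nat ((2 * m) choose m) * ((of_nat (m choose a))\<^sup>2 * (\<Sum>b\<le>m-a. (of_nat ((m - a) choose b))\<^sup>2)))"
    proof (intro sum.cong refl)
      fix a assume "a \<in> {..m}"
      then have a: "a \<le> m" by simp
      have "of_nat ((2 * a) choose a) * (of_nat ((2 * m) choose (2 * a)) * (of_nat ((2 * b) choose b) * (of_nat ((2 * (m - a)) choose (2 * b)) * of_nat ((2 * (m - a - b)) choose (m - a - b)))))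
          = (of_nat ((2 * m) choose m) * (of_nat (m choose a))\<^sup>2 * (of_nat ((m - a) choose b))\<^sup>2 :: complex)"
        if b: "b \<le> m - a" for b
      proof -
        from a b obtain c where m: "m = a + (b + c)"
          by (metis le_Suc_ex le_diff_conv2 add.commute add.assoc)
        have diffs: "2 * (m - a) = 2 * b + 2 * c" "m - a - b = c" "m - a = b + c" "2 * (b + c) = 2 * b + 2 * c"
          "2 * c = c + c" "2 * a = a + a" "2 * b = b + b" "2 * m = m + m" "2 * m = 2 * a + 2 * (b + c)"
          using m by simp_all
        have b1: "of_nat ((2 * a) choose a) = (fact (2 * a) / (fact a * fact a) :: complex)"
          unfolding diffs(6) by (rule binomial_add_fact)
        have b2: "of_nat ((2 * m) choose (2 * a)) = (fact (2 * m) / (fact (2 * a) * fact (2 * (b + c))) :: complex)"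
          unfolding diffs(9) by (rule binomial_add_fact)
        have b3: "of_nat ((2 * b) choose b) = (fact (2 * b) / (fact b * fact b) :: complex)"
          unfolding diffs(7) by (rule binomial_add_fact)
        have b4: "of_nat ((2 * (m - a)) choose (2 * b)) = (fact (2 * (b + c)) / (fact (2 * b) * fact (2 * c)) :: complex)"
          unfolding diffs(1,4) by (rule binomial_add_fact)
        have b5: "of_nat ((2 * (m - a - b)) choose (m - a - b)) = (fact (2 * c) / (fact c * fact c) :: complex)"
          unfolding diffs(2,5) by (rule binomial_add_fact)
        have b6: "of_nat ((2 * m) choose m) = (fact (2 * m) / (fact m * fact m) :: complex)"
          unfolding diffs(8) by (rule binomial_add_fact)
        have b7: "of_nat (m choose a) = (fact m / (fact a * fact (b + c)) :: complex)"
          unfolding m by (rule binomial_add_fact)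
        have b8: "of_nat ((m - a) choose b) = (fact (b + c) / (fact b * fact c) :: complex)"
          unfolding diffs(3) by (rule binomial_add_fact)
        show ?thesis
          unfolding b1 b2 b3 b4 b5 b6 b7 b8 by (simp add: power2_eq_square)
      qed
      then show "of_nat ((2 * a) choose a) * (of_nat ((2 * m) choose (2 * a))
       * (\<Sum>b\<le>m-a. of_nat ((2 * b) choose b) * (of_nat ((2 * (m - a)) choose (2 * b)) * of_nat ((2 * (m - a - b)) choose (m - a - b)))))
       = of_nat ((2 * m) choose m) * ((of_nat (m choose a))\<^sup>2 * (\<Sum>b\<le>m-a. (of_nat ((m - a) choose b))\<^sup>2 :: complex))"
        unfolding sum_distrib_left by (intro sum.cong refl) (simp add: mult.assoc)
    qed
    also have "\<dots> = of_nat ((2 * m) choose m) * (\<Sum>a\<le>m. (of_nat (m choose a))\<^sup>2 * of_nat ((2 * (m - a)) choose (m - a)))"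
      by (simp only: choose_square_sum_complex sum_distrib_left)
    also have "(\<Sum>a\<le>m. (of_nat (m choose a))\<^sup>2 * of_nat ((2 * (m - a)) choose (m - a))) = honeycomb m"
    proof -
      have "m choose (m - a) = m choose a" if "a \<le> m" for a
        using binomial_symmetric[OF that] by simp
      then show ?thesis
        unfolding honeycomb_def
        by (intro sum.reindex_bij_witness[of _ "\<lambda>a. m - a" "\<lambda>a. m - a"]) auto
    qed
    finally show ?thesis using n by (simp add: lattice_coeff_def)
  qed
  finally show ?thesis .
qed

text \<open>The monomials have exponents \<open>4i - n\<close>, \<open>4j - n\<close>,
  \<open>4k - n\<close>; all vanish only for \<open>i = j = k = n/4\<close>, which leaves a single
  multinomial coefficient.\<close>

lemma has_const_term_quartic:
  "has_const_term (\<lambda>v :: complex^3. ((v $ 1 ^ 4 + v $ 2 ^ 4 + v $ 3 ^ 4 + 1) / (v $ 1 * v $ 2 * v $ 3)) ^ n)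
     (if 4 dvd n then quartic_coeff (n div 4) else 0)"
proof -
  define I where "I = Sigma {..n} (\<lambda>i. Sigma {..n-i} (\<lambda>j. {..n-i-j}))"
  define a where "a = (\<lambda>(i, j, k). of_nat (n choose i) * of_nat ((n - i) choose j) * of_nat ((n - i - j) choose k) :: complex)"
  define e where "e = (\<lambda>t. if t = (1::nat) then (\<lambda>(i, j, k). 4 * int i - int n)
     else if t = 2 then (\<lambda>(i, j, k). 4 * int j - int n) else (\<lambda>(i :: nat, j :: nat, k). 4 * int k - int n))"
  have fin: "finite I" unfolding I_def by auto
  have "has_const_term (\<lambda>v :: complex^3. \<Sum>t\<in>I. a t * (v $ 1 powi e 1 t * v $ 2 powi e 2 t * v $ 3 powi e 3 t))
     (\<Sum>t | t \<in> I \<and> e 1 t = 0 \<and> e 2 t = 0 \<and> e 3 t = 0. a t)"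
    by (rule has_const_term_laurent3[OF fin])
  then have "has_const_term (\<lambda>v :: complex^3. ((v $ 1 ^ 4 + v $ 2 ^ 4 + v $ 3 ^ 4 + 1) / (v $ 1 * v $ 2 * v $ 3)) ^ n)
     (\<Sum>t | t \<in> I \<and> e 1 t = 0 \<and> e 2 t = 0 \<and> e 3 t = 0. a t)"
  proof (rule has_const_term_cong)
    fix v :: "complex^3" assume v: "\<And>i. cmod (v $ i) = 1"
    define x y z where "x = v $ 1" and "y = v $ 2" and "z = v $ 3"
    have nz: "x \<noteq> 0" "y \<noteq> 0" "z \<noteq> 0" using v[of 1] v[of 2] v[of 3] by (auto simp: x_def y_def z_def)
    have pw: "w powi (int m * 4 - int n) = (w ^ 4) ^ m / w ^ n" if "w \<noteq> 0" for w :: complex and m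
      
    proof -
      have eq: "int m * 4 - int n = int (4 * m) - int n" by simp
      show ?thesis unfolding eq using that
        by (simp only: power_int_diff power_int_of_nat power_mult simp_thms)
    qed
    have "((x ^ 4 + y ^ 4 + z ^ 4 + 1) / (x * y * z)) ^ n = (x ^ 4 + (y ^ 4 + (z ^ 4 + 1))) ^ n / (x ^ n * y ^ n * z ^ n)"
      by (simp add: power_divide power_mult_distrib add.assoc)
    also have "\<dots> = (\<Sum>i\<le>n. \<Sum>j\<le>n-i. \<Sum>k\<le>n-i-j. a (i, j, k) * (x powi e 1 (i, j, k) * y powi e 2 (i, j, k) * z powi e 3 (i, j, k)))"
      unfolding binomial_ring sum_distrib_left sum_divide_distrib
      by (intro sum.cong refl) (simp add: a_def e_def pw nz mult_ac)
    also have "\<dots> = (\<Sum>t\<in>I. a t * (x powi e 1 t * y powi e 2 t * z powi e 3 t))"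
      unfolding I_def by (simp add: sum.Sigma)
    finally show "(\<Sum>t\<in>I. a t * (v $ 1 powi e 1 t * v $ 2 powi e 2 t * v $ 3 powi e 3 t))
        = ((v $ 1 ^ 4 + v $ 2 ^ 4 + v $ 3 ^ 4 + 1) / (v $ 1 * v $ 2 * v $ 3)) ^ n"
      by (simp add: x_def y_def z_def)
  qed
  also have "(\<Sum>t | t \<in> I \<and> e 1 t = 0 \<and> e 2 t = 0 \<and> e 3 t = 0. a t) = (if 4 dvd n then quartic_coeff (n div 4) else 0)"
  proof (cases "4 dvd n")
    case True
    then obtain m where n: "n = 4 * m" by auto
    have e: "e 1 (i, j, k) = 4 * int i - int n" "e 2 (i, j, k) = 4 * int j - int n" "e 3 (i, j, k) = 4 * int k - int n"
      for i j k by (simp_all add: e_def)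
    have "{t. t \<in> I \<and> e 1 t = 0 \<and> e 2 t = 0 \<and> e 3 t = 0} = {(m, m, m)}"
    proof (intro equalityI subsetI)
      fix t assume t: "t \<in> {t. t \<in> I \<and> e 1 t = 0 \<and> e 2 t = 0 \<and> e 3 t = 0}"
      obtain i j k where ijk: "t = (i, j, k)" by (rule prod_cases3)
      have "4 * int i = int n" "4 * int j = int n" "4 * int k = int n"
        using t unfolding ijk mem_Collect_eq e by simp_all
      then show "t \<in> {(m, m, m)}" unfolding ijk n by simp
    next
      fix t assume "t \<in> {(m, m, m)}"
      then have t: "t = (m, m, m)" by simp
      show "t \<in> {t. t \<in> I \<and> e 1 t = 0 \<and> e 2 t = 0 \<and> e 3 t = 0}"
        unfolding t mem_Collect_eq e I_def by (simp add: n)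
    qed
    moreover have "a (m, m, m) = quartic_coeff m"
    proof -
      have d: "4 * m - m = m + 2 * m" "4 * m - m - m = m + m" "4 * m = m + 3 * m" "3 * m = m + 2 * m" "2 * m = m + m"
        by simp_all
      have "of_nat ((4 * m) choose m) = (fact (4 * m) / (fact m * fact (3 * m)) :: complex)"
        unfolding d(3) by (rule binomial_add_fact)
      moreover have "of_nat ((4 * m - m) choose m) = (fact (3 * m) / (fact m * fact (2 * m)) :: complex)"
        unfolding d(1,4) by (rule binomial_add_fact)
      moreover have "of_nat ((4 * m - m - m) choose m) = (fact (2 * m) / (fact m * fact m) :: complex)"
        unfolding d(2,5) by (rule binomial_add_fact)
      ultimately show ?thesis
        by (simp only: a_def n split quartic_coeff_def) (simp add: power4_eq_xxxx)
    qed
    ultimately show ?thesis using n by simp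
  next
    case False
    then have "4 * int i \<noteq> int n" for i
      by (metis dvd_triv_left int_dvd_int_iff of_nat_numeral of_nat_mult)
    then have "{t. t \<in> I \<and> e 1 t = 0 \<and> e 2 t = 0 \<and> e 3 t = 0} = {}"
      unfolding e_def by auto
    with False show ?thesis by (simp only: sum.empty if_False)
  qed
  finally show ?thesis .
qed

text \<open>With \<open>a = xy\<close>, \<open>b = xz\<close>, \<open>c = yz\<close> the Laurent polynomial below equals
  \<open>(1 + a + b + c) (1 + 1/a + 1/b + 1/c)\<close>, so its constant terms are sums of squares of multinomial
  coefficients.\<close>

lemma has_const_term_domb:
  "has_const_term (\<lambda>v :: complex^3. (4 + (v $ 1 + inverse (v $ 1)) * (v $ 2 + inverse (v $ 2))
      + (v $ 1 + inverse (v $ 1)) * (v $ 3 + inverse (v $ 3)) + (v $ 2 + inverse (v $ 2)) * (v $ 3 + inverse (v $ 3))) ^ n)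
     (domb n)"
proof -
  \<comment> \<open>The grouping \<open>(1 + xy) + (xz + yz)\<close> matches the form of
    \<open>domb\<close>: \<open>k\<close> factors come from the first bracket, \<open>i\<close> of
    them \<open>xy\<close>, and \<open>j\<close> of the others are \<open>xz\<close>.
    \<open>E1\<close>, \<open>E2\<close>, \<open>E3\<close> are the resulting exponents of
    \<open>x\<close>, \<open>y\<close>, \<open>z\<close>.\<close>
  define J where "J = Sigma {..n} (\<lambda>k. {..k} \<times> {..n-k})"
  define m where "m = (\<lambda>(k, i, j). of_nat (n choose k) * of_nat (k choose i) * of_nat ((n - k) choose j) :: complex)"
  define E1 where "E1 = (\<lambda>(k :: nat, i, j). int i + int j)"
  define E2 where "E2 = (\<lambda>(k, i, j). int i + int (n - k - j))"
  define E3 where "E3 = (\<lambda>(k, i :: nat, j). int j + int (n - k - j))"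
  have fin: "finite J" unfolding J_def by auto
  have "has_const_term (\<lambda>v :: complex^3. \<Sum>(s, t)\<in>J \<times> J. (m s * m t)
       * (v $ 1 powi (E1 s - E1 t) * v $ 2 powi (E2 s - E2 t) * v $ 3 powi (E3 s - E3 t)))
     (\<Sum>p | p \<in> J \<times> J \<and> E1 (fst p) - E1 (snd p) = 0 \<and> E2 (fst p) - E2 (snd p) = 0 \<and> E3 (fst p) - E3 (snd p) = 0.
        m (fst p) * m (snd p))"
    using has_const_term_laurent3[of "J \<times> J" "\<lambda>p. m (fst p) * m (snd p)" "\<lambda>p. E1 (fst p) - E1 (snd p)"
      "\<lambda>p. E2 (fst p) - E2 (snd p)" "\<lambda>p. E3 (fst p) - E3 (snd p)"] fin by (simp add: split_def)
  then have "has_const_term (\<lambda>v :: complex^3. (4 + (v $ 1 + inverse (v $ 1)) * (v $ 2 + inverse (v $ 2))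
      + (v $ 1 + inverse (v $ 1)) * (v $ 3 + inverse (v $ 3)) + (v $ 2 + inverse (v $ 2)) * (v $ 3 + inverse (v $ 3))) ^ n)
     (\<Sum>p | p \<in> J \<times> J \<and> E1 (fst p) - E1 (snd p) = 0 \<and> E2 (fst p) - E2 (snd p) = 0 \<and> E3 (fst p) - E3 (snd p) = 0.
        m (fst p) * m (snd p))"
  proof (rule has_const_term_cong)
    fix v :: "complex^3" assume v: "\<And>i. cmod (v $ i) = 1"
    define x y z where "x = v $ 1" and "y = v $ 2" and "z = v $ 3"
    have nz: "x \<noteq> 0" "y \<noteq> 0" "z \<noteq> 0" using v[of 1] v[of 2] v[of 3] by (auto simp: x_def y_def z_def)
    have expand: "(1 + x * y + (x * z + y * z)) ^ n = (\<Sum>t\<in>J. m t * (x powi E1 t * y powi E2 t * z powi E3 t))"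
      if nz: "x \<noteq> 0" "y \<noteq> 0" "z \<noteq> 0" for x y z :: complex
    proof -
      have "(1 + x * y + (x * z + y * z)) ^ n
          = (\<Sum>k\<le>n. of_nat (n choose k) * (x * y + 1) ^ k * (x * z + y * z) ^ (n - k))"
        unfolding binomial_ring[symmetric] by (simp add: add.commute)
      also have "\<dots> = (\<Sum>k\<le>n. \<Sum>i\<le>k. \<Sum>j\<le>n-k. m (k, i, j) * (x powi E1 (k, i, j) * y powi E2 (k, i, j) * z powi E3 (k, i, j)))"
      proof (intro sum.cong refl)
        fix k
        have "of_nat (n choose k) * (x * y + 1) ^ k * (x * z + y * z) ^ (n - k)
          = of_nat (n choose k) * ((\<Sum>i\<le>k. of_nat (k choose i) * (x * y) ^ i * 1 ^ (k - i))
             * (\<Sum>j\<le>n-k. of_nat ((n - k) choose j) * (x * z) ^ j * (y * z) ^ (n - k - j)))"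
          unfolding binomial_ring by (simp add: mult.assoc)
        also have "\<dots> = (\<Sum>i\<le>k. \<Sum>j\<le>n-k. of_nat (n choose k) * ((of_nat (k choose i) * (x * y) ^ i * 1 ^ (k - i))
             * (of_nat ((n - k) choose j) * (x * z) ^ j * (y * z) ^ (n - k - j))))"
          by (subst sum_product) (simp only: sum_distrib_left)
        also have "\<dots> = (\<Sum>i\<le>k. \<Sum>j\<le>n-k. m (k, i, j) * (x powi E1 (k, i, j) * y powi E2 (k, i, j) * z powi E3 (k, i, j)))"
          using nz by (intro sum.cong refl)
            (simp add: m_def E1_def E2_def E3_def power_int_add power_mult_distrib mult_ac del: of_nat_diff)
        finally show "of_nat (n choose k) * (x * y + 1) ^ k * (x * z + y * z) ^ (n - k)
          = (\<Sum>i\<le>k. \<Sum>j\<le>n-k. m (k, i, j) * (x powi E1 (k, i, j) * y powi E2 (k, i, j) * z powi E3 (k, i, j)))" .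
      qed
      also have "\<dots> = (\<Sum>t\<in>J. m t * (x powi E1 t * y powi E2 t * z powi E3 t))"
        unfolding J_def by (simp add: sum.Sigma sum.cartesian_product split_def)
      finally show ?thesis .
    qed
    have "4 + (x + inverse x) * (y + inverse y) + (x + inverse x) * (z + inverse z) + (y + inverse y) * (z + inverse z)
       = (1 + x * y + (x * z + y * z)) * (1 + inverse x * inverse y + (inverse x * inverse z + inverse y * inverse z))"
      using right_inverse[OF nz(1)] right_inverse[OF nz(2)] right_inverse[OF nz(3)] by algebra
    then have e1: "(4 + (x + inverse x) * (y + inverse y) + (x + inverse x) * (z + inverse z) + (y + inverse y) * (z + inverse z)) ^ n
       = (\<Sum>s\<in>J. m s * (x powi E1 s * y powi E2 s * z powi E3 s))
         * (\<Sum>t\<in>J. m t * (inverse x powi E1 t * inverse y powi E2 t * inverse z powi E3 t))"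
      using expand[OF nz] expand[of "inverse x" "inverse y" "inverse z"] nz by (simp only: power_mult_distrib) simp
    have e2: "(\<Sum>s\<in>J. m s * (x powi E1 s * y powi E2 s * z powi E3 s))
         * (\<Sum>t\<in>J. m t * (inverse x powi E1 t * inverse y powi E2 t * inverse z powi E3 t))
         = (\<Sum>(s, t)\<in>J \<times> J. (m s * (x powi E1 s * y powi E2 s * z powi E3 s))
         * (m t * (inverse x powi E1 t * inverse y powi E2 t * inverse z powi E3 t)))"
      by (simp only: sum_product sum.cartesian_product)
    have e3: "(\<Sum>(s, t)\<in>J \<times> J. (m s * (x powi E1 s * y powi E2 s * z powi E3 s))
         * (m t * (inverse x powi E1 t * inverse y powi E2 t * inverse z powi E3 t)))
       = (\<Sum>(s, t)\<in>J \<times> J. (m s * m t)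
       * (x powi (E1 s - E1 t) * y powi (E2 s - E2 t) * z powi (E3 s - E3 t)))"
    proof -
      have pw: "w powi (p - q) = w powi p * inverse w powi q" if "w \<noteq> 0" for w :: complex and p q
        using that by (simp add: power_int_diff power_int_inverse field_simps)
      have pt: "(m s * (x powi E1 s * y powi E2 s * z powi E3 s))
         * (m t * (inverse x powi E1 t * inverse y powi E2 t * inverse z powi E3 t))
         = (m s * m t) * (x powi (E1 s - E1 t) * y powi (E2 s - E2 t) * z powi (E3 s - E3 t))" for s t
        unfolding pw[OF nz(1)] pw[OF nz(2)] pw[OF nz(3)] by (simp only: mult_ac)
      show ?thesis by (simp only: pt)
    qed
    show "(\<Sum>(s, t)\<in>J \<times> J. (m s * m t)
       * (v $ 1 powi (E1 s - E1 t) * v $ 2 powi (E2 s - E2 t) * v $ 3 powi (E3 s - E3 t)))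
      = (4 + (v $ 1 + inverse (v $ 1)) * (v $ 2 + inverse (v $ 2))
      + (v $ 1 + inverse (v $ 1)) * (v $ 3 + inverse (v $ 3)) + (v $ 2 + inverse (v $ 2)) * (v $ 3 + inverse (v $ 3))) ^ n"
      unfolding x_def[symmetric] y_def[symmetric] z_def[symmetric] e1 e2 e3 by (rule refl)
  qed
  also have "{p. p \<in> J \<times> J \<and> E1 (fst p) - E1 (snd p) = 0 \<and> E2 (fst p) - E2 (snd p) = 0 \<and> E3 (fst p) - E3 (snd p) = 0}
     = (\<lambda>t. (t, t)) ` J"
  proof -
    \<comment> \<open>The pairwise sums \<open>i + j\<close>, \<open>i + l\<close>,
      \<open>j + l\<close> determine \<open>i\<close>, \<open>j\<close>, \<open>l\<close>, so a term
      pairs only with its own inverse and the constant term is a diagonal sum.\<close>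
    have "s = t" if st: "s \<in> J" "t \<in> J" "E1 s = E1 t" "E2 s = E2 t" "E3 s = E3 t" for s t
    proof -
      obtain k i j where s: "s = (k, i, j)" by (rule prod_cases3)
      obtain k' i' j' where t: "t = (k', i', j')" by (rule prod_cases3)
      have J: "i \<le> k" "k \<le> n" "j \<le> n - k" "i' \<le> k'" "k' \<le> n" "j' \<le> n - k'"
        using st(1,2) unfolding J_def s t by auto
      define l l' where "l = n - k - j" and "l' = n - k' - j'"
      have "i + j = i' + j'" "i + l = i' + l'" "j + l = j' + l'"
        using st(3-5) unfolding E1_def E2_def E3_def s t l_def[symmetric] l'_def[symmetric] split
        by (simp_all only: of_nat_add[symmetric] of_nat_eq_iff)
      then have "i = i'" "j = j'" "l = l'" by linarith+
      moreover have "k = n - j - l" "k' = n - j' - l'"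
        unfolding l_def l'_def using J by simp_all
      ultimately show ?thesis using s t by simp
    qed
    then show ?thesis by (intro equalityI subsetI) (fastforce simp: image_iff)+
  qed
  also have "(\<Sum>p\<in>(\<lambda>t. (t, t)) ` J. m (fst p) * m (snd p)) = (\<Sum>t\<in>J. (m t)\<^sup>2)"
    by (subst sum.reindex) (auto simp: inj_on_def power2_eq_square)
  also have "\<dots> = (\<Sum>k\<le>n. \<Sum>i\<le>k. \<Sum>j\<le>n-k. (m (k, i, j))\<^sup>2)"
    unfolding J_def by (simp add: sum.Sigma sum.cartesian_product split_def)
  also have "\<dots> = (\<Sum>k\<le>n. (of_nat (n choose k))\<^sup>2 * ((\<Sum>i\<le>k. of_nat (k choose i) ^ 2) * (\<Sum>j\<le>n-k. of_nat ((n - k) choose j) ^ 2)))"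
    by (intro sum.cong refl, subst sum_product) (simp add: m_def sum_distrib_left power_mult_distrib mult.assoc)
  also have "\<dots> = domb n"
    unfolding domb_def by (simp only: choose_square_sum_complex mult.assoc)
  finally show ?thesis .
qed

section \<open>Logarithmic series for \<open>f3\<close>, \<open>g2\<close>, \<open>g1\<close> and
  \<open>f4\<close> at large arguments\<close>

lemma sums_log_fps:
  assumes b: "\<And>n. cmod (b n) \<le> K ^ n" and s: "K * cmod s < 1"
  shows "(\<lambda>n. b n / of_nat n * s ^ n) sums eval_fps (log_fps b) s"
proof -
  have "cmod (b 1) \<le> K" using b[of 1] by simp
  then have K: "0 \<le> K" by (rule order_trans[OF norm_ge_zero])
  have "summable (\<lambda>n. b n / of_nat n * s ^ n)"
  proof (rule summable_comparison_test'[of "\<lambda>n. (K * cmod s) ^ n" 0])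
    show "summable (\<lambda>n. (K * cmod s) ^ n)"
      using s K by (simp add: summable_geometric)
    fix n
    show "cmod (b n / of_nat n * s ^ n) \<le> (K * cmod s) ^ n"
    proof (cases "n = 0")
      case False
      then have "cmod (b n) / real n \<le> cmod (b n)"
        by (simp add: divide_le_eq mult_le_cancel_left1)
      also have "\<dots> \<le> K ^ n" by (rule b)
      finally show ?thesis
        using mult_right_mono[of "cmod (b n) / real n" "K ^ n" "cmod s ^ n"]
        by (simp add: norm_mult norm_divide norm_power power_mult_distrib)
    qed simp
  qed
  then show ?thesis
    by (simp add: eval_fps_def log_fps_def summable_sums)
qed

lemma Re_divide_multiple:
  "Re (x / (of_nat (numeral k * n) * w)) = Re (x / (of_nat n * w)) / numeral k"
proof -
  have "x / (of_nat (numeral k * n) * w) = x / (of_nat n * w) / numeral k"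
    by (simp add: mult_ac)
  then show ?thesis by (simp only: Re_divide_numeral)
qed

lemma sums_Re_log_fps:
  assumes "\<And>n. cmod (b n) \<le> K ^ n" and "K < cmod u"
  shows "(\<lambda>n. Re (b n / (of_nat n * u ^ n))) sums Re (eval_fps (log_fps b) (1 / u))"
proof -
  have "cmod (b 1) \<le> K" using assms(1)[of 1] by simp
  then have K: "0 \<le> K" by (rule order_trans[OF norm_ge_zero])
  then have "K * cmod (1 / u) < 1"
    using assms(2) by (simp add: norm_divide divide_less_eq)
  from sums_Re[OF sums_log_fps[OF assms(1) this]] show ?thesis
    by (simp add: power_one_over)
qed

text \<open>The bound \<open>128 = 4 * 4 * 8\<close> for the polynomial on the torus serves twice:
  as threshold for \<open>u\<close> and as growth rate of the coefficients.\<close>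

lemma f3_eq:
  shows "128 < cmod u \<Longrightarrow> f3 u = ln (cmod u) - Re (eval_fps (log_fps cubic_coeff) (1 / u))"
    and "cmod (cubic_coeff n) \<le> 128 ^ n"
proof -
  define Q where "Q = (\<lambda>v :: complex^3. (v $ 1 + inverse (v $ 1))\<^sup>2 * (v $ 2 + inverse (v $ 2))\<^sup>2
      * (1 + v $ 3) ^ 3 * v $ 3 powi (-2))"
  have bound: "cmod (Q v) \<le> 128" if v: "\<And>i. cmod (v $ i) = 1" for v
  proof -
    have "cmod (1 + v $ 3) \<le> 2" using norm_triangle_ineq[of 1 "v $ 3"] v by simp
    then have "cmod (Q v) \<le> 2\<^sup>2 * 2\<^sup>2 * 2 ^ 3 * 1"
      unfolding Q_def norm_mult norm_power norm_power_int v
      by (intro mult_mono power_mono norm_plus_inverse_le v) auto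
    then show ?thesis by simp
  qed
  have ct: "has_const_term (\<lambda>v. Q v ^ n) (cubic_coeff n)" for n
    unfolding Q_def by (rule has_const_term_cubic)
  have cont: "continuous_on UNIV (\<lambda>\<theta>. Q (torus_point \<theta>))"
    unfolding Q_def by (auto intro!: continuous_intros)
  show bd: "cmod (cubic_coeff n) \<le> 128 ^ n" for n
    by (rule has_const_term_power_bound[OF bound ct])
  show "f3 u = ln (cmod u) - Re (eval_fps (log_fps cubic_coeff) (1 / u))" if u: "128 < cmod u"
  proof -
    have "f3 u = mahler_measure (\<lambda>v. u - Q v)"
      by (simp add: f3_def Q_def Let_def)
    with mahler_measure_series[OF cont bound u ct] sums_Re_log_fps[OF bd u]
    show ?thesis
      by (simp add: sums_iff)
  qed
qed

lemma g2_eq: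
  shows "16 < cmod u \<Longrightarrow> g2 u = ln (cmod u) - Re (eval_fps (log_fps domb) (1 / u))"
    and "cmod (domb n) \<le> 16 ^ n"
proof -
  define Q where "Q = (\<lambda>v :: complex^3. 4 + (v $ 1 + inverse (v $ 1)) * (v $ 2 + inverse (v $ 2))
      + (v $ 1 + inverse (v $ 1)) * (v $ 3 + inverse (v $ 3)) + (v $ 2 + inverse (v $ 2)) * (v $ 3 + inverse (v $ 3)))"
  have bound: "cmod (Q v) \<le> 16" if v: "\<And>i. cmod (v $ i) = 1" for v
  proof -
    have "cmod ((v $ i + inverse (v $ i)) * (v $ j + inverse (v $ j))) \<le> 2 * 2" for i j
      unfolding norm_mult by (intro mult_mono norm_plus_inverse_le v) auto
    then have "cmod (Q v) \<le> cmod 4 + 2 * 2 + 2 * 2 + 2 * 2"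
      unfolding Q_def by (intro norm_triangle_le add_mono order_refl)
    then show ?thesis by simp
  qed
  have ct: "has_const_term (\<lambda>v. Q v ^ n) (domb n)" for n
    unfolding Q_def by (rule has_const_term_domb)
  have cont: "continuous_on UNIV (\<lambda>\<theta>. Q (torus_point \<theta>))"
    unfolding Q_def by (auto intro!: continuous_intros)
  show bd: "cmod (domb n) \<le> 16 ^ n" for n
    by (rule has_const_term_power_bound[OF bound ct])
  show "g2 u = ln (cmod u) - Re (eval_fps (log_fps domb) (1 / u))" if u: "16 < cmod u"
  proof -
    have "cmod (u - Q v) = cmod (- u + 4 + (v $ 1 + inverse (v $ 1)) * (v $ 2 + inverse (v $ 2))
        + (v $ 1 + inverse (v $ 1)) * (v $ 3 + inverse (v $ 3)) + (v $ 2 + inverse (v $ 2)) * (v $ 3 + inverse (v $ 3)))" for v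
      unfolding Q_def by (subst norm_minus_commute) (simp add: algebra_simps)
    then have "g2 u = mahler_measure (\<lambda>v. u - Q v)"
      by (simp add: g2_def mahler_measure_def Let_def)
    with mahler_measure_series[OF cont bound u ct] sums_Re_log_fps[OF bd u]
    show ?thesis
      by (simp add: sums_iff)
  qed
qed

text \<open>Odd powers have no constant term, so the series runs over \<open>2m\<close>, whose
  denominators give the factor 1/2. The change from \<open>u\<close> to \<open>-u\<close> is
  invisible in even powers.\<close>

lemma g1_eq:
  shows "6 < cmod u \<Longrightarrow> g1 u = ln (cmod u) - Re (eval_fps (log_fps lattice_coeff) (1 / u\<^sup>2)) / 2"
    and "cmod (lattice_coeff n) \<le> 36 ^ n"
proof -
  define Q where "Q = (\<lambda>v :: complex^3. v $ 1 + inverse (v $ 1) + (v $ 2 + inverse (v $ 2)) + (v $ 3 + inverse (v $ 3)))"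
  define c where "c = (\<lambda>n. if even n then lattice_coeff (n div 2) else 0)"
  have bound: "cmod (Q v) \<le> 6" if v: "\<And>i. cmod (v $ i) = 1" for v
  proof -
    have "cmod (Q v) \<le> 2 + 2 + 2"
      unfolding Q_def by (intro norm_triangle_le add_mono norm_plus_inverse_le v)
    then show ?thesis by simp
  qed
  have ct: "has_const_term (\<lambda>v. Q v ^ n) (c n)" for n
    unfolding Q_def c_def by (rule has_const_term_lattice)
  have cont: "continuous_on UNIV (\<lambda>\<theta>. Q (torus_point \<theta>))"
    unfolding Q_def by (auto intro!: continuous_intros)
  show bd: "cmod (lattice_coeff n) \<le> 36 ^ n" for n
    using has_const_term_power_bound[OF bound ct, of "2 * n"] by (simp add: c_def power_mult)
  show "g1 u = ln (cmod u) - Re (eval_fps (log_fps lattice_coeff) (1 / u\<^sup>2)) / 2" if u: "6 < cmod u"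
  proof -
    have u': "6 < cmod (- u)" using u by simp
    have "cmod (- u - Q v) = cmod (u + v $ 1 + inverse (v $ 1) + v $ 2 + inverse (v $ 2) + v $ 3 + inverse (v $ 3))" for v
      unfolding Q_def by (subst norm_minus_cancel[symmetric]) (simp add: algebra_simps)
    then have g1: "g1 u = mahler_measure (\<lambda>v. - u - Q v)"
      by (simp add: g1_def mahler_measure_def Let_def)
    have "6\<^sup>2 < (cmod u)\<^sup>2" by (rule power_strict_mono) (use u in auto)
    then have "36 < cmod (u\<^sup>2)" by (simp add: norm_power)
    from sums_divide[OF sums_Re_log_fps[OF bd this], of 2]
    have "(\<lambda>n. Re (c (2 * n) / (of_nat (2 * n) * (- u) ^ (2 * n)))) sums (Re (eval_fps (log_fps lattice_coeff) (1 / u\<^sup>2)) / 2)"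
      by (simp add: c_def power_mult Re_divide_multiple del: of_nat_mult)
    moreover have "(\<lambda>n. Re (c (2 * n) / (of_nat (2 * n) * (- u) ^ (2 * n)))) sums S
        \<longleftrightarrow> (\<lambda>n. Re (c n / (of_nat n * (- u) ^ n))) sums S" for S
      by (rule sums_mono_reindex[of "\<lambda>n. 2 * n"]) (auto simp: strict_mono_def c_def)
    ultimately have "(\<lambda>n. Re (c n / (of_nat n * (- u) ^ n))) sums (Re (eval_fps (log_fps lattice_coeff) (1 / u\<^sup>2)) / 2)"
      by blast
    with mahler_measure_series[OF cont bound u' ct]
    show ?thesis
      unfolding g1 by (simp add: sums_iff)
  qed
qed

text \<open>Division by the unimodular \<open>xyz\<close> turns the polynomial into
  \<open>w + Q\<close> with \<open>w^4 = u\<close>. Only powers divisible by 4 have constant terms,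
  and the resulting 1/4 cancels the 4 in \<open>f4\<close>; the threshold is
  \<open>256 = 4^4\<close>.\<close>

lemma f4_eq:
  shows "256 < cmod u \<Longrightarrow> f4 u = ln (cmod u) - Re (eval_fps (log_fps quartic_coeff) (1 / u))"
    and "cmod (quartic_coeff n) \<le> 256 ^ n"
proof -
  define Q where "Q = (\<lambda>v :: complex^3. (v $ 1 ^ 4 + v $ 2 ^ 4 + v $ 3 ^ 4 + 1) / (v $ 1 * v $ 2 * v $ 3))"
  define c where "c = (\<lambda>n. if 4 dvd n then quartic_coeff (n div 4) else 0)"
  have bound: "cmod (Q v) \<le> 4" if v: "\<And>i. cmod (v $ i) = 1" for v
  proof -
    have "cmod (v $ 1 ^ 4 + v $ 2 ^ 4 + v $ 3 ^ 4 + 1) \<le> 1 + 1 + 1 + 1"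
      by (intro norm_triangle_le add_mono) (simp_all add: norm_power v)
    then show ?thesis unfolding Q_def norm_divide norm_mult v by simp
  qed
  have ct: "has_const_term (\<lambda>v. Q v ^ n) (c n)" for n
    unfolding Q_def c_def by (rule has_const_term_quartic)
  have cont: "continuous_on UNIV (\<lambda>\<theta>. Q (torus_point \<theta>))"
    unfolding Q_def by (auto intro!: continuous_intros)
  show bd: "cmod (quartic_coeff n) \<le> 256 ^ n" for n
    using has_const_term_power_bound[OF bound ct, of "4 * n"] by (simp add: c_def power_mult)
  show "f4 u = ln (cmod u) - Re (eval_fps (log_fps quartic_coeff) (1 / u))" if u: "256 < cmod u"
  proof -
    define w where "w = u powr (1/4)"
    have w4: "w ^ 4 = u"
      using u by (auto simp: w_def powr_def exp_of_nat_mult[symmetric])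
    then have nw: "cmod w ^ 4 = cmod u" by (metis norm_power)
    have "4 < cmod w"
    proof (rule power_less_imp_less_base[of 4 4])
      show "4 ^ 4 < cmod w ^ 4" unfolding nw using u by simp
    qed simp
    then have w: "4 < cmod (- w)" by simp
    have ln_w: "ln (cmod u) = 4 * ln (cmod w)"
      unfolding nw[symmetric] using \<open>4 < cmod w\<close> by (simp add: ln_realpow)
    have "ln (cmod (- w - Q v)) = ln (cmod (v $ 1 ^ 4 + v $ 2 ^ 4 + v $ 3 ^ 4 + 1 + w * v $ 1 * v $ 2 * v $ 3))"
      if v: "\<And>i. cmod (v $ i) = 1" for v
    proof -
      have nz: "v $ i \<noteq> 0" for i using v[of i] by auto
      have "v $ 1 ^ 4 + v $ 2 ^ 4 + v $ 3 ^ 4 + 1 + w * v $ 1 * v $ 2 * v $ 3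
          = - ((- w - Q v) * (v $ 1 * v $ 2 * v $ 3))"
        unfolding Q_def using nz by (simp add: field_simps)
      then have "cmod (v $ 1 ^ 4 + v $ 2 ^ 4 + v $ 3 ^ 4 + 1 + w * v $ 1 * v $ 2 * v $ 3) = cmod (- w - Q v)"
        by (simp only: norm_minus_cancel norm_mult v mult_1_right)
      then show ?thesis by simp
    qed
    then have f4: "f4 u = 4 * mahler_measure (\<lambda>v. - w - Q v)"
      by (simp add: f4_def mahler_measure_def Let_def w_def)
    have "(- w) ^ 4 = u" using w4 by simp
    with sums_divide[OF sums_Re_log_fps[OF bd u], of 4]
    have "(\<lambda>n. Re (c (4 * n) / (of_nat (4 * n) * (- w) ^ (4 * n)))) sums (Re (eval_fps (log_fps quartic_coeff) (1 / u)) / 4)"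
      by (simp add: c_def power_mult Re_divide_multiple del: of_nat_mult)
    moreover have "(\<lambda>n. Re (c (4 * n) / (of_nat (4 * n) * (- w) ^ (4 * n)))) sums S
        \<longleftrightarrow> (\<lambda>n. Re (c n / (of_nat n * (- w) ^ n))) sums S" for S
      by (rule sums_mono_reindex[of "\<lambda>n. 4 * n"]) (auto simp: strict_mono_def c_def)
    ultimately have "(\<lambda>n. Re (c n / (of_nat n * (- w) ^ n))) sums (Re (eval_fps (log_fps quartic_coeff) (1 / u)) / 4)"
      by blast
    with mahler_measure_series[OF cont bound w ct]
    show ?thesis
      unfolding f4 ln_w by (simp add: sums_iff)
  qed
qed

section \<open>The two identities\<close>

text \<open>Since \<open>ln |X| = q ln |1 - c t| - p ln |t|\<close>, only the part
  \<open>p ln |t|\<close>, singular at \<open>t = 0\<close>, remains outside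
  \<open>log_comp\<close>.\<close>

lemma log_comp_eq:
  assumes "t \<noteq> 0" "1 - c * t \<noteq> 0" and X: "X = (1 - c * t) ^ q / t ^ p"
  shows "ln (cmod X) - Re (eval_fps (log_fps b) (1 / X)) = Re (log_comp p q c b t) - real p * ln (cmod t)"
proof -
  have "1 / X = t ^ p * inverse (1 - c * t) ^ q"
    unfolding X by (simp add: field_simps)
  moreover have "ln (cmod X) = real q * ln (cmod (1 - c * t)) - real p * ln (cmod t)"
    unfolding X using assms(1,2) by (simp add: norm_divide norm_power ln_div ln_realpow)
  ultimately show ?thesis
    using assms(2) by (simp add: log_comp_def)
qed

lemma eventually_large:
  assumes "0 < p"
  shows "\<forall>\<^sub>F t in at 0. t \<noteq> 0 \<and> 1 - c * t \<noteq> 0 \<and> M < cmod ((1 - c * t) ^ q / t ^ p)"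
proof -
  have "((\<lambda>t. 1 - c * t) \<longlongrightarrow> 1 - c * 0) (at 0)"
    by (intro tendsto_intros)
  then have 1: "\<forall>\<^sub>F t in at 0. 1 - c * t \<noteq> 0"
    by (rule tendsto_imp_eventually_ne) simp
  have "((\<lambda>t. t ^ p * inverse (1 - c * t) ^ q) \<longlongrightarrow> 0 ^ p * inverse (1 - c * 0) ^ q) (at 0)"
    by (intro tendsto_intros) auto
  then have "((\<lambda>t. t ^ p * inverse (1 - c * t) ^ q) \<longlongrightarrow> 0) (at 0)"
    using assms by (simp add: power_0_left)
  from tendstoD[OF this, of "1 / (\<bar>M\<bar> + 1)"]
  have 2: "\<forall>\<^sub>F t in at 0. cmod (t ^ p * inverse (1 - c * t) ^ q) < 1 / (\<bar>M\<bar> + 1)"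
    by simp
  have 3: "\<forall>\<^sub>F t in at 0. t \<noteq> (0 :: complex)"
    by (simp add: eventually_at_filter)
  from 1 2 3 show ?thesis
  proof eventually_elim
    case (elim t)
    let ?X = "(1 - c * t) ^ q / t ^ p"
    have "t ^ p * inverse (1 - c * t) ^ q = 1 / ?X" by (simp add: field_simps)
    with elim have "1 / cmod ?X < 1 / (\<bar>M\<bar> + 1)" by (simp only: norm_divide norm_one)
    moreover have "0 < cmod ?X" using elim by simp
    ultimately have "\<bar>M\<bar> + 1 < cmod ?X"
      by (simp add: frac_less2 divide_less_eq less_divide_eq split: if_splits)
    with elim show ?case by auto
  qed
qed

text \<open>With the common \<open>a(t)\<close> the claim rests on \<open>1/2 = 1/20 + 9/20\<close>
  and \<open>(1 - 9t)/2 = (1 - 81t)/20 + 3 (3 - 3t)/20\<close>.\<close>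

lemma almkvist_zudilin_identity:
  "\<forall>\<^sub>F t in nhds 0. log_comp 1 2 (-9) lattice_coeff t / 2
     = log_comp 1 4 (-27) quartic_coeff t / 20 + 3 * log_comp 3 4 (-3) quartic_coeff t / 20"
proof -
  define E where "E = (\<lambda>t. log_comp 1 2 (-9) lattice_coeff t / 2
     - (log_comp 1 4 (-27) quartic_coeff t / 20 + 3 * log_comp 3 4 (-3) quartic_coeff t / 20))"
  have lat: "comp_coeff 1 2 (-9) lattice_coeff = comp_coeff 3 4 (-3) quartic_coeff"
    by (rule ext) (rule lattice_eq_quartic_3)
  have quart: "comp_coeff 1 4 (-27) quartic_coeff = comp_coeff 3 4 (-3) quartic_coeff"
    by (rule ext) (rule quartic_1_eq_quartic_3)
  have init: "lattice_coeff 0 = 1" "quartic_coeff 0 = 1"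
    by (simp_all add: lattice_coeff_def honeycomb_def quartic_coeff_def)
  have d1: "\<forall>\<^sub>F t in nhds 0. \<exists>D. (log_comp 1 2 (-9) lattice_coeff has_field_derivative D) (at t) \<and>
    t * D = of_nat 1 - eval_fps (Abs_fps (comp_coeff 3 4 (-3) quartic_coeff)) t * (of_nat 1 + (of_nat 2 - of_nat 1) * (-9) * t)"
    using has_field_derivative_log_comp[of lattice_coeff 36 1 2 "-9", OF g1_eq(2)] init unfolding lat by simp
  have d2: "\<forall>\<^sub>F t in nhds 0. \<exists>D. (log_comp 1 4 (-27) quartic_coeff has_field_derivative D) (at t) \<and>
    t * D = of_nat 1 - eval_fps (Abs_fps (comp_coeff 3 4 (-3) quartic_coeff)) t * (of_nat 1 + (of_nat 4 - of_nat 1) * (-27) * t)"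
    using has_field_derivative_log_comp[of quartic_coeff 256 1 4 "-27", OF f4_eq(2)] init unfolding quart by simp
  have d3: "\<forall>\<^sub>F t in nhds 0. \<exists>D. (log_comp 3 4 (-3) quartic_coeff has_field_derivative D) (at t) \<and>
    t * D = of_nat 3 - eval_fps (Abs_fps (comp_coeff 3 4 (-3) quartic_coeff)) t * (of_nat 3 + (of_nat 4 - of_nat 3) * (-3) * t)"
    using has_field_derivative_log_comp[of quartic_coeff 256 3 4 "-3", OF f4_eq(2)] init by simp
  from d1 d2 d3 have "\<forall>\<^sub>F t in nhds 0. \<exists>D. (E has_field_derivative D) (at t) \<and> t * D = 0"
  proof eventually_elim
    case (elim t)
    then obtain D1 D2 D3 where D: "(log_comp 1 2 (-9) lattice_coeff has_field_derivative D1) (at t)"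
      "(log_comp 1 4 (-27) quartic_coeff has_field_derivative D2) (at t)"
      "(log_comp 3 4 (-3) quartic_coeff has_field_derivative D3) (at t)"
      and e: "t * D1 = of_nat 1 - eval_fps (Abs_fps (comp_coeff 3 4 (-3) quartic_coeff)) t * (of_nat 1 + (of_nat 2 - of_nat 1) * (-9) * t)"
      "t * D2 = of_nat 1 - eval_fps (Abs_fps (comp_coeff 3 4 (-3) quartic_coeff)) t * (of_nat 1 + (of_nat 4 - of_nat 1) * (-27) * t)"
      "t * D3 = of_nat 3 - eval_fps (Abs_fps (comp_coeff 3 4 (-3) quartic_coeff)) t * (of_nat 3 + (of_nat 4 - of_nat 3) * (-3) * t)"
      by blast
    have "(E has_field_derivative (D1 / 2 - (D2 / 20 + 3 * D3 / 20))) (at t)"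
      unfolding E_def by (intro DERIV_diff DERIV_add DERIV_cdivide DERIV_cmult D)
    moreover have "t * (D1 / 2 - (D2 / 20 + 3 * D3 / 20)) = (t * D1) / 2 - ((t * D2) / 20 + 3 * (t * D3) / 20)"
      by (simp add: algebra_simps)
    then have "t * (D1 / 2 - (D2 / 20 + 3 * D3 / 20)) = 0"
      unfolding e by (simp add: field_simps)
    ultimately show ?case by blast
  qed
  from constant_near_0[OF this] show ?thesis
    by (simp add: E_def log_comp_0)
qed

text \<open>The balance is \<open>1 = -1/15 + 16/15\<close> and
  \<open>1 = -(1 + 32t)/15 + 8 (2 + 4t)/15\<close>. The triple \<open>(1, 1, 0)\<close> is the
  trivial pullback, with \<open>X = z\<close>.\<close>

lemma domb_identity:
  "\<forall>\<^sub>F t in nhds 0. log_comp 1 1 0 domb t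
     = - log_comp 1 3 16 (\<lambda>k. (-1) ^ k * cubic_coeff k) t / 15 + 8 * log_comp 2 3 4 cubic_coeff t / 15"
proof -
  let ?alt = "\<lambda>k. (-1) ^ k * cubic_coeff k"
  define E where "E = (\<lambda>t. log_comp 1 1 0 domb t
     - (- log_comp 1 3 16 ?alt t / 15 + 8 * log_comp 2 3 4 cubic_coeff t / 15))"
  have dom: "comp_coeff 1 1 0 domb = domb"
  proof
    fix n
    have "comp_coeff 1 1 0 domb n = (\<Sum>k\<in>{n}. domb k * of_nat (n choose k) * 0 ^ (n - k))"
      unfolding comp_coeff_def by (rule sum.mono_neutral_cong_right) auto
    then show "comp_coeff 1 1 0 domb n = domb n" by simp
  qed
  have c1: "comp_coeff 1 3 16 ?alt = domb" and c2: "comp_coeff 2 3 4 cubic_coeff = domb"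
    by (rule ext, rule cubic_1_eq_domb) (rule ext, rule cubic_2_eq_domb)
  have init: "domb 0 = 1" "cubic_coeff 0 = 1"
    by (simp_all add: domb_def cubic_coeff_def)
  have alt_bound: "cmod (?alt n) \<le> 128 ^ n" for n
    using f3_eq(2)[of n] by (simp add: norm_mult norm_power)
  have d1: "\<forall>\<^sub>F t in nhds 0. \<exists>D. (log_comp 1 1 0 domb has_field_derivative D) (at t) \<and>
    t * D = of_nat 1 - eval_fps (Abs_fps domb) t * (of_nat 1 + (of_nat 1 - of_nat 1) * 0 * t)"
    using has_field_derivative_log_comp[of domb 16 1 1 0, OF g2_eq(2)] init unfolding dom by simp
  have d2: "\<forall>\<^sub>F t in nhds 0. \<exists>D. (log_comp 1 3 16 ?alt has_field_derivative D) (at t) \<and>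
    t * D = of_nat 1 - eval_fps (Abs_fps domb) t * (of_nat 1 + (of_nat 3 - of_nat 1) * 16 * t)"
    using has_field_derivative_log_comp[of ?alt 128 1 3 16, OF alt_bound] init unfolding c1 by simp
  have d3: "\<forall>\<^sub>F t in nhds 0. \<exists>D. (log_comp 2 3 4 cubic_coeff has_field_derivative D) (at t) \<and>
    t * D = of_nat 2 - eval_fps (Abs_fps domb) t * (of_nat 2 + (of_nat 3 - of_nat 2) * 4 * t)"
    using has_field_derivative_log_comp[of cubic_coeff 128 2 3 4, OF f3_eq(2)] init unfolding c2 by simp
  from d1 d2 d3 have "\<forall>\<^sub>F t in nhds 0. \<exists>D. (E has_field_derivative D) (at t) \<and> t * D = 0"
  proof eventually_elim
    case (elim t)
    then obtain D1 D2 D3 where D: "(log_comp 1 1 0 domb has_field_derivative D1) (at t)"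
      "(log_comp 1 3 16 ?alt has_field_derivative D2) (at t)"
      "(log_comp 2 3 4 cubic_coeff has_field_derivative D3) (at t)"
      and e: "t * D1 = of_nat 1 - eval_fps (Abs_fps domb) t * (of_nat 1 + (of_nat 1 - of_nat 1) * 0 * t)"
      "t * D2 = of_nat 1 - eval_fps (Abs_fps domb) t * (of_nat 1 + (of_nat 3 - of_nat 1) * 16 * t)"
      "t * D3 = of_nat 2 - eval_fps (Abs_fps domb) t * (of_nat 2 + (of_nat 3 - of_nat 2) * 4 * t)"
      by blast
    have "(E has_field_derivative (D1 - (- D2 / 15 + 8 * D3 / 15))) (at t)"
      unfolding E_def by (intro DERIV_diff DERIV_add DERIV_minus DERIV_cdivide DERIV_cmult D)
    moreover have "t * (D1 - (- D2 / 15 + 8 * D3 / 15)) = t * D1 - (- (t * D2) / 15 + 8 * (t * D3) / 15)"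
      by (simp add: algebra_simps)
    then have "t * (D1 - (- D2 / 15 + 8 * D3 / 15)) = 0"
      unfolding e by (simp add: field_simps)
    ultimately show ?case by blast
  qed
  from constant_near_0[OF this] show ?thesis
    by (simp add: E_def log_comp_0)
qed

lemma filterlim_one_div_power_at_infinity:
  fixes c :: complex
  assumes "c \<noteq> 0" "0 < n"
  shows "filterlim (\<lambda>z. 1 / (c * z ^ n)) (at 0) at_infinity"
proof -
  have "((\<lambda>z. inverse c * inverse z ^ n) \<longlongrightarrow> inverse c * 0 ^ n) at_infinity"
    by (intro tendsto_intros tendsto_inverse_0)
  then have "((\<lambda>z. 1 / (c * z ^ n)) \<longlongrightarrow> 0) at_infinity"
    using assms by (simp add: field_simps power_0_left)
  moreover have "\<forall>\<^sub>F z in at_infinity. 1 / (c * z ^ n) \<noteq> 0"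
    using eventually_not_equal_at_infinity[of 0] by eventually_elim (use assms in auto)
  ultimately show ?thesis by (simp add: filterlim_at)
qed

lemma g1_identity:
  "\<forall>\<^sub>F z in at_infinity. g1 (3 * (z + inverse z))
      = 1/20 * f4 (9 * (3 + z^2)^4 / z^6) + 3/20 * f4 (9 * (3 + z powi (-2))^4 / z powi (-6))"
proof -
  have lin1: "g = 1/20 * f + 3/20 * f'"
    if "g = (R - real 1 * l) / 2" "f = S - real 1 * l" "f' = T - real 3 * l" "R / 2 = S / 20 + 3 * T / 20"
    for g f f' R S T l :: real
    using that by (simp add: field_simps)
  \<comment> \<open>\<open>z\<close> is quantified inside because \<open>t\<close> determines it
    only up to sign; the statement then transfers along \<open>t = 1 / (9 z^2)\<close>.\<close>
  have ev: "\<forall>\<^sub>F t :: complex in at 0. \<forall>z. z \<noteq> 0 \<and> t = 1 / (9 * z\<^sup>2) \<longrightarrow> g1 (3 * (z + inverse z))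
      = 1/20 * f4 (9 * (3 + z^2)^4 / z^6) + 3/20 * f4 (9 * (3 + z powi (-2))^4 / z powi (-6))"
    using eventually_large[of 1 "-9" 36 2, OF zero_less_one] eventually_large[of 1 "-27" 256 4, OF zero_less_one]
      eventually_large[of 3 "-3" 256 4, OF zero_less_numeral]
      filter_leD[OF at_within_le_nhds almkvist_zudilin_identity]
  proof eventually_elim
    case (elim t)
    show ?case
    proof (intro allI impI, elim conjE)
      fix z assume z: "z \<noteq> 0" and t: "t = 1 / (9 * z\<^sup>2)"
      let ?u = "3 * (z + inverse z)" and ?A = "9 * (3 + z^2)^4 / z^6" and ?B = "9 * (3 + z powi (-2))^4 / z powi (-6)"
      have u: "?u\<^sup>2 = (1 - (-9) * t) ^ 2 / t ^ 1"
        unfolding t using z by (simp add: field_simps power2_eq_square)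
      have A: "?A = (1 - (-27) * t) ^ 4 / t ^ 1"
        unfolding t using z by (simp add: field_simps eval_nat_numeral)
      have B: "?B = (1 - (-3) * t) ^ 4 / t ^ 3"
        unfolding t using z by (simp add: power_int_minus field_simps eval_nat_numeral)
      have "36 < cmod ?u ^ 2" using elim(1) unfolding u[symmetric] by (simp add: norm_power)
      then have "6 < cmod ?u" using power_less_imp_less_base[of 6 2 "cmod ?u"] by simp
      \<comment> \<open>It is the square of \<open>?u\<close>, not \<open>?u\<close> itself, that is
        the rational function \<open>X\<close> of \<open>t\<close>.\<close>
      moreover have "ln (cmod ?u) = ln (cmod (?u\<^sup>2)) / 2"
        using \<open>6 < cmod ?u\<close> unfolding norm_power by (subst ln_realpow) auto
      ultimately have g: "g1 ?u = (ln (cmod (?u\<^sup>2)) - Re (eval_fps (log_fps lattice_coeff) (1 / ?u\<^sup>2))) / 2"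
        by (simp only: g1_eq(1) diff_divide_distrib)
      have "g1 ?u = (Re (log_comp 1 2 (-9) lattice_coeff t) - real 1 * ln (cmod t)) / 2"
        unfolding g by (subst log_comp_eq[OF _ _ u]) (use elim in auto)
      moreover have "f4 ?A = Re (log_comp 1 4 (-27) quartic_coeff t) - real 1 * ln (cmod t)"
        by (subst f4_eq(1)) (use elim(2) A log_comp_eq[OF _ _ A] in auto)
      moreover have "f4 ?B = Re (log_comp 3 4 (-3) quartic_coeff t) - real 3 * ln (cmod t)"
        by (subst f4_eq(1)) (use elim(3) B log_comp_eq[OF _ _ B] in auto)
      moreover have "Re (log_comp 1 2 (-9) lattice_coeff t) / 2
          = Re (log_comp 1 4 (-27) quartic_coeff t) / 20 + 3 * Re (log_comp 3 4 (-3) quartic_coeff t) / 20"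
        using arg_cong[OF elim(4), of Re] by simp
      ultimately show "g1 ?u = 1/20 * f4 ?A + 3/20 * f4 ?B"
        by (rule lin1)
    qed
  qed
  have lim: "filterlim (\<lambda>z :: complex. 1 / (9 * z\<^sup>2)) (at 0) at_infinity"
    by (rule filterlim_one_div_power_at_infinity) auto
  from eventually_compose_filterlim[OF ev lim] eventually_not_equal_at_infinity[of 0] show ?thesis
    by eventually_elim (elim allE impE, auto)
qed

text \<open>Alternating signs amount to evaluating the series of \<open>cubic_coeff\<close> at
  \<open>1 / (-u)\<close>.\<close>

lemma f3_alt_eq:
  assumes "128 < cmod u"
  shows "f3 (- u) = ln (cmod u) - Re (eval_fps (log_fps (\<lambda>k. (-1) ^ k * cubic_coeff k)) (1 / u))"
proof -
  have "eval_fps (log_fps (\<lambda>k. (-1) ^ k * cubic_coeff k)) s = eval_fps (log_fps cubic_coeff) (- s)" for s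
    unfolding eval_fps_def log_fps_def by (simp add: power_minus[of s] mult_ac)
  then show ?thesis using f3_eq(1)[of "- u"] assms by simp
qed

lemma g2_identity:
  "\<forall>\<^sub>F z in at_infinity. g2 z = - (1/15) * f3 ((16 - z)^3 / z^2) + 8/15 * f3 (- ((4 - z)^3 / z))"
proof -
  let ?alt = "\<lambda>k. (-1) ^ k * cubic_coeff k"
  have lin2: "g = - (1/15) * f + 8/15 * f'"
    if "g = R - real 1 * l" "f = S - real 1 * l" "f' = T - real 2 * l" "R = - S / 15 + 8 * T / 15"
    for g f f' R S T l :: real
    using that by (simp add: field_simps)
  have ev: "\<forall>\<^sub>F t :: complex in at 0. \<forall>z. z \<noteq> 0 \<and> t = 1 / (1 * z ^ 1) \<longrightarrow>
      g2 z = - (1/15) * f3 ((16 - z)^3 / z^2) + 8/15 * f3 (- ((4 - z)^3 / z))"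
    using eventually_large[of 1 0 16 1, OF zero_less_one] eventually_large[of 1 16 128 3, OF zero_less_one]
      eventually_large[of 2 4 128 3, OF zero_less_numeral]
      filter_leD[OF at_within_le_nhds domb_identity]
  proof eventually_elim
    case (elim t)
    show ?case
    proof (intro allI impI, elim conjE)
      fix z assume z: "z \<noteq> 0" and t: "t = 1 / (1 * z ^ 1)"
      let ?A = "(1 - 16 * t) ^ 3 / t ^ 1" and ?B = "- ((4 - z)^3 / z)"
      have u: "z = (1 - 0 * t) ^ 1 / t ^ 1"
        unfolding t using z by simp
      \<comment> \<open>\<open>16 - z = - z (1 - 16 t)\<close>, and the cube keeps the minus sign;
        for \<open>4 - z\<close> the explicit sign in the argument of \<open>f3\<close>
        compensates.\<close>
      have A: "(16 - z)^3 / z^2 = - ?A"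
        unfolding t using z by (simp add: field_simps eval_nat_numeral)
      have B: "?B = (1 - 4 * t) ^ 3 / t ^ 2"
        unfolding t using z by (simp add: field_simps eval_nat_numeral)
      have "g2 z = Re (log_comp 1 1 0 domb t) - real 1 * ln (cmod t)"
        by (subst g2_eq(1)) (use elim(1) u log_comp_eq[OF _ _ u] in auto)
      moreover have "f3 ((16 - z)^3 / z^2) = Re (log_comp 1 3 16 ?alt t) - real 1 * ln (cmod t)"
        unfolding A by (subst f3_alt_eq) (use elim(2) log_comp_eq[OF _ _ refl, of t 16 3 1 ?alt] in auto)
      moreover have "f3 ?B = Re (log_comp 2 3 4 cubic_coeff t) - real 2 * ln (cmod t)"
        by (subst f3_eq(1)) (use elim(3) B log_comp_eq[OF _ _ B] in auto)
      moreover have "Re (log_comp 1 1 0 domb t)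
          = - Re (log_comp 1 3 16 ?alt t) / 15 + 8 * Re (log_comp 2 3 4 cubic_coeff t) / 15"
        using arg_cong[OF elim(4), of Re] by simp
      ultimately show "g2 z = - (1/15) * f3 ((16 - z)^3 / z^2) + 8/15 * f3 ?B"
        by (rule lin2)
    qed
  qed
  have lim: "filterlim (\<lambda>z :: complex. 1 / (1 * z ^ 1)) (at 0) at_infinity"
    by (rule filterlim_one_div_power_at_infinity) auto
  from eventually_compose_filterlim[OF ev lim] eventually_not_equal_at_infinity[of 0] show ?thesis
    by eventually_elim (elim allE impE, auto)
qed

theorem theorem3:
  shows "\<forall>\<^sub>F z :: complex in at_infinity.
    g1 (3 * (z + inverse z))
      = 1/20 * f4 (9 * (3 + z^2)^4 / z^6) + 3/20 * f4 (9 * (3 + z powi (-2))^4 / z powi (-6)) \<and>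
    g2 z = - (1/15) * f3 ((16 - z)^3 / z^2) + 8/15 * f3 (- ((4 - z)^3 / z))"
  using g1_identity g2_identity by (rule eventually_conj)

end
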